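(* Let $\alpha\in\mathbb{R}$ and $\varepsilon>0$. There is an absolute constant $C>0$ and a constant $c=c(\varepsilon)>0$ such that the following holds. For real $x\ge 3$ put $Y:=x\left(\frac{\log\log x}{C\log x}\right)^2$. Whenever $y\le Y$ and there exists an irreducible fraction $u/s$ (with $s\ge1$) satisfying $\left|\alpha-\frac{u}{s}\right|\le\frac{1}{s^2}$ and $\varepsilon s^2\le y\le s^2/12$, we have $$\frac{1}{x}\sum_{\substack{n\in\mathbb{Z}\\ -y<n\le x}}\left|\sum_{\substack{m\in\mathbb{Z},\ n<m\le n+y\\ 1\le m\le x}}\tau(m)\,\mathrm{e}(\alpha m)\right|^2\ \ge\ c\, y\,\big(\log(x/y)\big)^2\log(Y/y).$$ In particular, for every irrational $\alpha$, $$\limsup_{x\to\infty} x^{-1/2}(\log x)(\log\log x)^{-2}\left|\sum_{n\le x}\tau(n)\,\mathrm{e}(\alpha n)\right|>0 .$$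
   Context: $\tau(m)$ denotes the number of positive divisors of $m$, and $\mathrm{e}(\beta):=e^{2\pi i\beta}$ for real $\beta$. Sums over $n\le x$ run over positive integers.
   Formalization: The mean-square bound is proved under the additional condition y ≥ 1; for 0 < y < 1 no interval (n, n+y] with n an integer contains an integer, so the left side is 0 and the printed inequality fails whenever y < Y (e.g. α = 0, u/s = 0/1, ε = y = 1/12, x large). *)

theory Defs
  imports Complex_Main "HOL-Library.Extended_Real"
begin

definition divisor_tau :: "nat \<Rightarrow> nat" where
  "divisor_tau m = card {d. d dvd m}"

definition expi :: "real \<Rightarrow> complex" where
  "expi \<beta> = exp (2 * of_real pi * \<i> * of_real \<beta>)"

definition Ybound :: "real \<Rightarrow> real \<Rightarrow> real" where
  "Ybound C x = x * (ln (ln x) / (C * ln x)) ^ 2"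

(* The window n < m <= n + y has integer endpoint n, so it is empty for every n when y < 1; the
   lower bound for the mean square is therefore only meaningful for y >= 1. *)
definition short_sum :: "real \<Rightarrow> real \<Rightarrow> real \<Rightarrow> int \<Rightarrow> complex" where
  "short_sum \<alpha> x y n =
     (\<Sum>m\<in>{m::nat. n < int m \<and> real m \<le> real_of_int n + y \<and> 1 \<le> m \<and> real m \<le> x}.
        of_nat (divisor_tau m) * expi (\<alpha> * real m))"

definition long_sum :: "real \<Rightarrow> real \<Rightarrow> complex" where
  "long_sum \<alpha> x =
     (\<Sum>n\<in>{n::nat. 1 \<le> n \<and> real n \<le> x}. of_nat (divisor_tau n) * expi (\<alpha> * real n))"

end

(* Let F(n) be the sum over the window (n, n + y].  For a fraction r near alpha, the weighted sum
   c(r) of e((r - alpha) n) F(n) is a sum over k <= y of e((alpha - r) k) M(k), where M(k) is a smoothed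
   sum of tau(m) e(r m) over m of size N^2, with N^2 comparable to x.  A smooth form of Dirichlet's
   hyperbola method, with summation by parts carried out twice, shows that M(k) has main term at least
   N^2 / (2 q) ln (N / (2 q)) and error O(q), q being the denominator of r.

   The hypothesis y <= s^2 / 12 makes this available for every reduced fraction r between u/s and
   its Farey neighbour u'/s' with s/2 <= s' <= s: such r lie within 3 / s^2 of alpha, so that the
   terms of the sum over k do not cancel.  These fractions are the mediants
   (a u' + (k - a) u) / (a s' + (k - a) s) with a coprime to k; there are totient k of them for each k, with
   denominator at most k s, so the sum of |c(r)|^2 gains one logarithm from the sum of totient k / k^2.
   The large sieve for these well-spaced points bounds the sum of |c(r)|^2 by 3 N^2 times the sum of
   |F(n)|^2.  The result is of order x y ln(x/y)^3 once x/y is large in terms of epsilon, which y <= Y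
   enforces for large x; Y <= x then gives the claim.  For bounded x the window that contains only the
   integer 1 suffices.

   For irrational alpha take s the denominator of a good approximation and x a large constant times s^2:
   some window sum, a difference of two long sums, is then at least a constant times s. *)

theory Submission
  imports Defs "HOL-Analysis.Analysis" "HOL-Number_Theory.Number_Theory" "HOL-Real_Asymp.Real_Asymp"
begin

section \<open>Second differences and exponential sums\<close>

text \<open>The shape of the weights is dictated by the error O(q). A sharp cut-off bounds an inner
  sum at phase t by 1/|sin(pi t)|, and summing over residues mod q then costs a factor ln q, which a
  ratio x/y that is merely large in terms of \<epsilon> cannot absorb. For a piecewise linear weight
  the second differences add up to its total change of slope, here O(1/N), so the bound becomes 1/(N
  sin(pi t)^2). The squares sum to O(q^2) over one period, and about N/q periods give O(q), free of
  logarithms.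

  The cube of the logarithm is made of two factors ln(N / (2 q)) from squaring the main term and one
  from the totients. Taking k <= H with H^2 s <= N makes all three at least of order ln(H / 2); for
  H near sqrt(N/s) this is comparable to ln(x/y), because (N/s)^2 is at least of order \<epsilon>
  x/y.

  Keeping to the fractions between u/s and one neighbour confines the frequencies to an interval of
  length at most 1/2, so distances mod 1 are ordinary absolute values. Their spacing 1/(q q') >=
  1/N^2 matches the length of the weight, so the sieve loses a constant factor only. The constant C
  is taken to be 1.\<close>

lemma expi_add: "expi (a + b) = expi a * expi b"
  by (simp add: expi_def distrib_left exp_add)

lemma expi_minus: "expi (- a) = cnj (expi a)"
  by (simp add: expi_def exp_cnj)

lemma expi_0 [simp]: "expi 0 = 1"
  by (simp add: expi_def)

lemma expi_eq_cis: "expi a = cis (2 * pi * a)"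
  by (simp add: expi_def cis_conv_exp mult_ac)

lemma expi_of_int [simp]: "expi (of_int n) = 1"
  unfolding expi_eq_cis by (rule cis_multiple_2pi) simp

lemma norm_expi [simp]: "norm (expi a) = 1"
  by (simp add: expi_eq_cis)

lemma Re_expi: "Re (expi a) = cos (2 * pi * a)"
  by (simp add: expi_eq_cis)

lemma expi_add_minus_two:
  "expi a + expi (- a) - 2 = - of_real (4 * (sin (pi * a)) ^ 2)"
proof -
  have "cos (2 * pi * a) = 1 - 2 * (sin (pi * a)) ^ 2"
    using cos_double_sin[of "pi * a"] by (simp add: mult_ac)
  then show ?thesis
    by (simp add: expi_eq_cis complex_eq_iff)
qed

lemma Re_expi_ge_half:
  assumes "\<bar>a\<bar> \<le> 1 / 8"
  shows "Re (expi a) \<ge> 1 / 2"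
proof -
  have "2 * pi * \<bar>a\<bar> \<le> 2 * pi * (1 / 6)"
    using assms by (intro mult_left_mono) auto
  then have "2 * pi * \<bar>a\<bar> \<le> pi / 3" by simp
  then have "cos (pi / 3) \<le> cos (2 * pi * \<bar>a\<bar>)"
    by (intro cos_monotone_0_pi_le) auto
  also have "cos (2 * pi * \<bar>a\<bar>) = cos (2 * pi * a)"
    by (cases "a \<ge> 0") (auto simp: abs_if)
  finally show ?thesis by (simp add: Re_expi cos_60)
qed

text \<open>Jordan's inequality: sin is concave on [0, pi], so it lies above its chord from 0 to pi
  / 2.\<close>

lemma abs_sin_pi_ge:
  assumes "\<bar>a\<bar> \<le> 1 / 2"
  shows "\<bar>sin (pi * a)\<bar> \<ge> 2 * \<bar>a\<bar>"
proof -
  have conc: "concave_on {0..pi} sin"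
    unfolding concave_on_def
  proof (rule f''_ge0_imp_convex[where f' = "\<lambda>x. - cos x" and f'' = sin])
    show "convex {0..pi::real}" by simp
  next
    fix x :: real assume "x \<in> {0..pi}"
    show "((\<lambda>x. - sin x) has_real_derivative - cos x) (at x)"
      by (auto intro!: derivative_eq_intros)
    show "((\<lambda>x. - cos x) has_real_derivative sin x) (at x)"
      by (auto intro!: derivative_eq_intros)
    show "0 \<le> sin x" using \<open>x \<in> {0..pi}\<close> by (simp add: sin_ge_zero)
  qed
  have "sin ((1 - 2 * \<bar>a\<bar>) *\<^sub>R 0 + (2 * \<bar>a\<bar>) *\<^sub>R (pi / 2)) \<ge> (1 - 2 * \<bar>a\<bar>) * sin 0 + (2 * \<bar>a\<bar>) * sin (pi / 2)"
    by (rule concave_onD[OF conc]) (use assms in auto)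
  then have "sin (pi * \<bar>a\<bar>) \<ge> 2 * \<bar>a\<bar>" by (simp add: mult_ac)
  moreover have "\<bar>sin (pi * a)\<bar> = \<bar>sin (pi * \<bar>a\<bar>)\<bar>"
    by (cases "a \<ge> 0") auto
  ultimately show ?thesis by linarith
qed

definition second_diff :: "(int \<Rightarrow> real) \<Rightarrow> int \<Rightarrow> real" where
  "second_diff f e = f (e + 1) - 2 * f e + f (e - 1)"

text \<open>A discrete Leibniz rule. The mixed term is split into a forward and a backward part,
  each of which can be summed against the total variation of one factor.\<close>

lemma second_diff_mult:
  "second_diff (\<lambda>e. f e * g e) e =
     f e * second_diff g e + g e * second_diff f e
     + (f (e + 1) - f e) * (g (e + 1) - g e) + (f e - f (e - 1)) * (g e - g (e - 1))"
  by (simp add: second_diff_def algebra_simps)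

lemma sum_shift_int:
  fixes g :: "int \<Rightarrow> 'a::comm_monoid_add"
  shows "(\<Sum>e\<in>{a..b}. g (e + c)) = (\<Sum>e\<in>{a + c..b + c}. g e)"
  by (rule sum.reindex_bij_witness[where i = "\<lambda>e. e - c" and j = "\<lambda>e. e + c"]) auto

text \<open>Summation by parts, carried out twice.\<close>

lemma norm_sum_expi_le:
  assumes "\<And>e. e < a \<or> b < e \<Longrightarrow> f e = 0"
  shows "norm (\<Sum>e\<in>{a..b}. of_real (f e) * expi (t * of_int e)) * (4 * (sin (pi * t)) ^ 2)
           \<le> (\<Sum>e\<in>{a-1..b+1}. \<bar>second_diff f e\<bar>)"
proof -
  define g where "g e = of_real (f e) * expi (t * of_int e)" for e
  define S where "S = (\<Sum>e\<in>{a..b}. g e)"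
  have g0: "g e = 0" if "e < a \<or> b < e" for e using assms[OF that] by (simp add: g_def)
  \<comment> \<open>The range is one wider than the support on either side, so a shift by at most 1
    still covers the support.\<close>
  have ext: "(\<Sum>e\<in>{a-1+c..b+1+c}. g e) = S" if "\<bar>c\<bar> \<le> 1" for c
    unfolding S_def by (rule sum.mono_neutral_right) (use that g0 in auto)
  have e1: "expi (t * of_int (e + 1)) = expi (t * of_int e) * expi t" for e
    using expi_add[of "t * of_int e" t] by (simp add: algebra_simps)
  have e2: "expi (t * of_int (e - 1)) = expi (t * of_int e) * expi (- t)" for e
    using expi_add[of "t * of_int e" "- t"] by (simp add: algebra_simps)
  have inv: "expi t * expi (- t) = 1" using expi_add[of t "- t"] by simp
  have eq: "of_real (second_diff f e) * expi (t * of_int e)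
        = expi (- t) * g (e + 1) - 2 * g e + expi t * g (e - 1)" for e
    unfolding g_def e1 e2 second_diff_def using inv
    by (simp add: ring_distribs mult_ac) (simp add: inv flip: mult.assoc)
  have "(\<Sum>e\<in>{a-1..b+1}. of_real (second_diff f e) * expi (t * of_int e))
      = expi (- t) * (\<Sum>e\<in>{a-1..b+1}. g (e + 1)) - 2 * (\<Sum>e\<in>{a-1..b+1}. g e) + expi t * (\<Sum>e\<in>{a-1..b+1}. g (e - 1))"
    unfolding eq by (simp add: sum.distrib sum_subtractf sum_distrib_left)
  also have "\<dots> = expi (- t) * S - 2 * S + expi t * S"
    using sum_shift_int[of g 1 "a-1" "b+1"] sum_shift_int[of g "-1" "a-1" "b+1"]
      ext[of 0] ext[of 1] ext[of "-1"] by simp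
  \<comment> \<open>Taking second differences multiplies the exponential sum by -4 sin(pi
    t)^2.\<close>
  also have "\<dots> = (expi t + expi (- t) - 2) * S" by (simp add: algebra_simps)
  also have "norm \<dots> = norm S * (4 * (sin (pi * t)) ^ 2)"
    unfolding expi_add_minus_two norm_mult by (simp add: norm_power abs_mult)
  finally have "norm S * (4 * (sin (pi * t)) ^ 2)
      = norm (\<Sum>e\<in>{a-1..b+1}. of_real (second_diff f e) * expi (t * of_int e))"
    by simp
  also have "\<dots> \<le> (\<Sum>e\<in>{a-1..b+1}. \<bar>second_diff f e\<bar>)"
    by (rule order_trans[OF norm_sum]) (simp add: norm_mult)
  finally show ?thesis by (simp add: S_def g_def)
qed

section \<open>Hinges, and the tent and ramp weights built from them\<close>

definition hinge :: "real \<Rightarrow> real \<Rightarrow> int \<Rightarrow> real" where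
  "hinge d c e = max 0 (d * of_int e - c)"

lemma hinge_step:
  assumes "d \<ge> 0"
  shows "0 \<le> hinge d c (e + 1) - hinge d c e" "hinge d c (e + 1) - hinge d c e \<le> d"
  using assms by (auto simp: hinge_def max_def algebra_simps)

lemma second_diff_hinge_nonneg: "d \<ge> 0 \<Longrightarrow> second_diff (hinge d c) e \<ge> 0"
  by (auto simp: second_diff_def hinge_def max_def algebra_simps)

lemma sum_telescope_int:
  fixes g :: "int \<Rightarrow> 'a::ab_group_add"
  assumes "a \<le> b + 1"
  shows "(\<Sum>e\<in>{a..b}. g (e + 1) - g e) = g (b + 1) - g a"
  using sum_shift_int[of g 1 a b] assms
proof -
  have "{a..b+1} = insert a {a+1..b+1}" "{a..b+1} = insert (b+1) {a..b}" using assms by auto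
  then have "g a + (\<Sum>e\<in>{a+1..b+1}. g e) = g (b + 1) + (\<Sum>e\<in>{a..b}. g e)"
    by (metis atLeastAtMost_iff finite_atLeastAtMost_int sum.insert
        add.commute less_add_one not_le)
  then show ?thesis
    unfolding sum_subtractf sum_shift_int[of g 1 a b] by (simp add: algebra_simps)
qed

text \<open>By convexity the second differences are nonnegative, so no absolute values are needed
  and they telescope to a change of slope, from at least 0 to at most d. Writing a weight as a
  combination of hinges thus avoids locating its kinks among the integers.\<close>

lemma sum_second_diff_hinge_le:
  assumes "d \<ge> 0"
  shows "(\<Sum>e\<in>{a..b}. second_diff (hinge d c) e) \<le> d"
proof (cases "a \<le> b + 1")
  case True
  let ?D = "\<lambda>e. hinge d c e - hinge d c (e - 1)"
  have "(\<Sum>e\<in>{a..b}. second_diff (hinge d c) e) = (\<Sum>e\<in>{a..b}. ?D (e + 1) - ?D e)"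
    using second_diff_hinge_nonneg[OF assms, of c]
    by (intro sum.cong) (auto simp: second_diff_def abs_of_nonneg)
  also have "\<dots> = ?D (b + 1) - ?D a" by (rule sum_telescope_int[OF True])
  also have "\<dots> \<le> d"
    using hinge_step[OF assms, of c b] hinge_step[OF assms, of c "a - 1"] by simp
  finally show ?thesis .
qed (use assms in auto)

text \<open>A triangle on (L, 3 L) with peak 1 at 2 L. The support stays away from 0, so that after
  a shift by k <= L it lies within (L, 4 L).\<close>

definition tent :: "real \<Rightarrow> real \<Rightarrow> real" where
  "tent L t = max 0 (1 - \<bar>t - 2 * L\<bar> / L)"

text \<open>Rises linearly from 0 at - W to 1 at W; the symmetry about (0, 1/2) is what the
  hyperbola method uses.\<close>

definition ramp :: "real \<Rightarrow> real \<Rightarrow> real" where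
  "ramp W t = (max 0 (t + W) - max 0 (t - W)) / (2 * W)"

lemma tent_nonneg: "0 \<le> tent L t"
  by (simp add: tent_def)

lemma tent_le_1: "L > 0 \<Longrightarrow> tent L t \<le> 1"
  by (simp add: tent_def)

lemma tent_eq_0: "L > 0 \<Longrightarrow> t \<le> L \<or> 3 * L \<le> t \<Longrightarrow> tent L t = 0"
  by (auto simp: tent_def max_def field_simps abs_if split: if_splits)

lemma tent_ge_half: "L > 0 \<Longrightarrow> \<bar>t - 2 * L\<bar> \<le> L / 2 \<Longrightarrow> tent L t \<ge> 1 / 2"
  by (auto simp: tent_def field_simps)

text \<open>The slope of a triangle changes in the proportions 1, -2, 1 at its three
  corners.\<close>

lemma tent_eq_hinge:
  assumes "L > 0"
  shows "tent L (d * of_int e - k)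
     = (1 / L) * (hinge d (L + k) e - 2 * hinge d (2 * L + k) e + hinge d (3 * L + k) e)"
proof -
  define t where "t = d * of_int e - k"
  have "L * tent L t = max 0 (L - \<bar>t - 2 * L\<bar>)"
    using assms by (simp add: tent_def max_mult_distrib_left right_diff_distrib)
  also have "\<dots> = max 0 (t - L) - 2 * max 0 (t - 2 * L) + max 0 (t - 3 * L)"
    using assms by (simp add: max_def abs_if)
  also have "\<dots> = hinge d (L + k) e - 2 * hinge d (2 * L + k) e + hinge d (3 * L + k) e"
    by (simp add: hinge_def t_def diff_diff_eq add.commute)
  finally show ?thesis
    using assms by (simp add: t_def field_simps)
qed

lemma tent_lipschitz:
  assumes "L > 0"
  shows "\<bar>tent L s - tent L t\<bar> \<le> \<bar>s - t\<bar> / L"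
proof -
  have "\<bar>tent L s - tent L t\<bar> \<le> \<bar>\<bar>t - 2 * L\<bar> / L - \<bar>s - 2 * L\<bar> / L\<bar>"
    unfolding tent_def by linarith
  also have "\<dots> = \<bar>\<bar>t - 2 * L\<bar> - \<bar>s - 2 * L\<bar>\<bar> / L"
    using assms by (simp flip: diff_divide_distrib)
  also have "\<dots> \<le> \<bar>s - t\<bar> / L" using assms by (intro divide_right_mono) linarith+
  finally show ?thesis .
qed

lemma sum_second_diff_tent_le:
  assumes "L > 0" "d \<ge> 0"
  shows "(\<Sum>e\<in>{a..b}. \<bar>second_diff (\<lambda>e. tent L (d * of_int e - k)) e\<bar>) \<le> 4 * d / L"
proof -
  have step: "\<bar>second_diff (\<lambda>e. tent L (d * of_int e - k)) e\<bar>
      \<le> (1 / L) * (second_diff (hinge d (L + k)) e + 2 * second_diff (hinge d (2 * L + k)) e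
           + second_diff (hinge d (3 * L + k)) e)" for e
  proof -
    have eq: "second_diff (\<lambda>e. tent L (d * of_int e - k)) e
       = (1 / L) * (second_diff (hinge d (L + k)) e - 2 * second_diff (hinge d (2 * L + k)) e
           + second_diff (hinge d (3 * L + k)) e)"
      unfolding tent_eq_hinge[OF assms(1)] second_diff_def by (simp add: algebra_simps)
    have "\<bar>second_diff (\<lambda>e. tent L (d * of_int e - k)) e\<bar> = (1 / L) * \<bar>second_diff (hinge d (L + k)) e - 2 * second_diff (hinge d (2 * L + k)) e
           + second_diff (hinge d (3 * L + k)) e\<bar>"
      using assms unfolding eq by (simp add: abs_mult)
    also have "\<dots> \<le> (1 / L) * (second_diff (hinge d (L + k)) e + 2 * second_diff (hinge d (2 * L + k)) e
           + second_diff (hinge d (3 * L + k)) e)"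
      using assms second_diff_hinge_nonneg[OF assms(2)] by (intro mult_left_mono) (simp_all add: abs_le_iff)
    finally show ?thesis .
  qed
  have "(\<Sum>e\<in>{a..b}. \<bar>second_diff (\<lambda>e. tent L (d * of_int e - k)) e\<bar>)
      \<le> (\<Sum>e\<in>{a..b}. (1 / L) * (second_diff (hinge d (L + k)) e + 2 * second_diff (hinge d (2 * L + k)) e
           + second_diff (hinge d (3 * L + k)) e))"
    by (intro sum_mono step)
  also have "\<dots> = (1 / L) * ((\<Sum>e\<in>{a..b}. second_diff (hinge d (L + k)) e)
      + 2 * (\<Sum>e\<in>{a..b}. second_diff (hinge d (2 * L + k)) e)
      + (\<Sum>e\<in>{a..b}. second_diff (hinge d (3 * L + k)) e))"
    by (simp add: sum_distrib_left sum.distrib algebra_simps)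
  also have "\<dots> \<le> (1 / L) * (d + 2 * d + d)"
    using assms by (intro mult_left_mono add_mono sum_second_diff_hinge_le) auto
  finally show ?thesis by simp
qed

lemma ramp_nonneg: "W > 0 \<Longrightarrow> 0 \<le> ramp W t"
  by (simp add: ramp_def)

lemma ramp_le_1: "W > 0 \<Longrightarrow> ramp W t \<le> 1"
  by (auto simp: ramp_def max_def field_simps)

lemma ramp_eq_0: "t \<le> - W \<Longrightarrow> W > 0 \<Longrightarrow> ramp W t = 0"
proof -
  assume "t \<le> - W" "W > 0"
  then have "max 0 (t + W) = 0" "max 0 (t - W) = 0" by auto
  then show ?thesis by (simp add: ramp_def)
qed

lemma ramp_eq_1: "W \<le> t \<Longrightarrow> W > 0 \<Longrightarrow> ramp W t = 1"
  unfolding ramp_def by (subst (1 2) max_absorb2) (auto simp: field_simps)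

lemma ramp_add_minus: "W > 0 \<Longrightarrow> ramp W t + ramp W (- t) = 1"
proof -
  assume W: "W > 0"
  have "max 0 (t + W) - max 0 (t - W) + (max 0 (- t + W) - max 0 (- t - W)) = 2 * W"
    using W by (auto simp: max_def)
  then show ?thesis
    unfolding ramp_def add_divide_distrib[symmetric] using W by simp
qed

lemma ramp_mono: "W > 0 \<Longrightarrow> s \<le> t \<Longrightarrow> ramp W s \<le> ramp W t"
  unfolding ramp_def by (intro divide_right_mono) auto

lemma ramp_eq_hinge:
  "ramp W (of_int e - d) = (1 / (2 * W)) * (hinge 1 (d - W) e - hinge 1 (d + W) e)"
  by (simp add: ramp_def hinge_def algebra_simps diff_divide_distrib)

lemma sum_second_diff_ramp_le:
  assumes "W > 0"
  shows "(\<Sum>e\<in>{a..b}. \<bar>second_diff (\<lambda>e. ramp W (of_int e - d)) e\<bar>) \<le> 1 / W"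
proof -
  have step: "\<bar>second_diff (\<lambda>e. ramp W (of_int e - d)) e\<bar>
      \<le> (1 / (2 * W)) * (second_diff (hinge 1 (d - W)) e + second_diff (hinge 1 (d + W)) e)" for e
  proof -
    have eq: "second_diff (\<lambda>e. ramp W (of_int e - d)) e
       = (1 / (2 * W)) * (second_diff (hinge 1 (d - W)) e - second_diff (hinge 1 (d + W)) e)"
      unfolding ramp_eq_hinge second_diff_def by (simp add: algebra_simps)
    have "\<bar>second_diff (\<lambda>e. ramp W (of_int e - d)) e\<bar> = (1 / (2 * W)) * \<bar>second_diff (hinge 1 (d - W)) e - second_diff (hinge 1 (d + W)) e\<bar>"
      using assms unfolding eq by (simp add: abs_mult)
    also have "\<dots> \<le> (1 / (2 * W)) * (second_diff (hinge 1 (d - W)) e + second_diff (hinge 1 (d + W)) e)"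
      using assms second_diff_hinge_nonneg[of 1] by (intro mult_left_mono) (simp_all add: abs_le_iff)
    finally show ?thesis .
  qed
  have "(\<Sum>e\<in>{a..b}. \<bar>second_diff (\<lambda>e. ramp W (of_int e - d)) e\<bar>)
      \<le> (\<Sum>e\<in>{a..b}. (1 / (2 * W)) * (second_diff (hinge 1 (d - W)) e + second_diff (hinge 1 (d + W)) e))"
    by (intro sum_mono step)
  also have "\<dots> = (1 / (2 * W)) * ((\<Sum>e\<in>{a..b}. second_diff (hinge 1 (d - W)) e)
      + (\<Sum>e\<in>{a..b}. second_diff (hinge 1 (d + W)) e))"
    by (simp add: sum_distrib_left sum.distrib algebra_simps)
  also have "\<dots> \<le> (1 / (2 * W)) * (1 + 1)"
    using assms by (intro mult_left_mono add_mono sum_second_diff_hinge_le) auto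
  finally show ?thesis using assms by simp
qed

lemma sum_ramp_step_le:
  assumes "W > 0"
  shows "(\<Sum>e\<in>{a..b}. \<bar>ramp W (of_int (e + 1) - d) - ramp W (of_int e - d)\<bar>) \<le> 1"
proof (cases "a \<le> b + 1")
  case True
  let ?g = "\<lambda>e. ramp W (of_int e - d)"
  have "(\<Sum>e\<in>{a..b}. \<bar>?g (e + 1) - ?g e\<bar>) = (\<Sum>e\<in>{a..b}. ?g (e + 1) - ?g e)"
    using ramp_mono[OF assms] by (intro sum.cong refl abs_of_nonneg) simp
  also have "\<dots> = ?g (b + 1) - ?g a" by (rule sum_telescope_int[OF True])
  also have "\<dots> \<le> 1" using ramp_le_1[OF assms, of "of_int (b+1) - d"] ramp_nonneg[OF assms, of "of_int a - d"] by linarith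
  finally show ?thesis .
qed auto

text \<open>In the Leibniz rule both factors are at most 1: the tent contributes 4 d / L and the
  ramp 1 / W. Each of the two mixed terms contributes d / L, the Lipschitz constant of the tent
  times the total variation 1 of the ramp.\<close>

lemma sum_second_diff_tent_ramp_le:
  assumes "L > 0" "W > 0" "d \<ge> 0"
  shows "(\<Sum>e\<in>{a..b}. \<bar>second_diff (\<lambda>e. tent L (d * of_int e - k) * ramp W (of_int e - d)) e\<bar>)
           \<le> 6 * d / L + 1 / W"
proof -
  define g where "g e = tent L (d * of_int e - k)" for e
  define h where "h e = ramp W (of_int e - d)" for e
  have g: "0 \<le> g e" "g e \<le> 1" and h: "0 \<le> h e" "h e \<le> 1" for e
    using assms by (auto simp: g_def h_def tent_nonneg tent_le_1 ramp_nonneg ramp_le_1)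
  have dg: "\<bar>g (e + 1) - g e\<bar> \<le> d / L" for e
    using tent_lipschitz[OF assms(1), of "d * of_int (e + 1) - k" "d * of_int e - k"] assms
    by (simp add: g_def algebra_simps)
  have dg': "\<bar>g e - g (e - 1)\<bar> \<le> d / L" for e
    using dg[of "e - 1"] by simp
  have step: "\<bar>second_diff (\<lambda>e. g e * h e) e\<bar> \<le> \<bar>second_diff h e\<bar> + \<bar>second_diff g e\<bar>
      + d / L * \<bar>h (e + 1) - h e\<bar> + d / L * \<bar>h e - h (e - 1)\<bar>" for e
  proof -
    have 1: "\<bar>g e * second_diff h e\<bar> \<le> \<bar>second_diff h e\<bar>"
      unfolding abs_mult using g[of e] by (intro mult_left_le_one_le) auto
    have 2: "\<bar>h e * second_diff g e\<bar> \<le> \<bar>second_diff g e\<bar>"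
      unfolding abs_mult using h[of e] by (intro mult_left_le_one_le) auto
    have 3: "\<bar>(g (e + 1) - g e) * (h (e + 1) - h e)\<bar> \<le> d / L * \<bar>h (e + 1) - h e\<bar>"
      unfolding abs_mult by (intro mult_right_mono dg abs_ge_zero)
    have 4: "\<bar>(g e - g (e - 1)) * (h e - h (e - 1))\<bar> \<le> d / L * \<bar>h e - h (e - 1)\<bar>"
      unfolding abs_mult by (intro mult_right_mono dg' abs_ge_zero)
    show ?thesis
      unfolding second_diff_mult
      by (rule order_trans[OF abs_triangle_ineq add_mono[OF order_trans[OF abs_triangle_ineq
              add_mono[OF order_trans[OF abs_triangle_ineq add_mono[OF 1 2]] 3]] 4]])
  qed
  have "(\<Sum>e\<in>{a..b}. \<bar>second_diff (\<lambda>e. g e * h e) e\<bar>)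
     \<le> (\<Sum>e\<in>{a..b}. \<bar>second_diff h e\<bar> + \<bar>second_diff g e\<bar>
      + d / L * \<bar>h (e + 1) - h e\<bar> + d / L * \<bar>h e - h (e - 1)\<bar>)"
    by (intro sum_mono step)
  also have "\<dots> = (\<Sum>e\<in>{a..b}. \<bar>second_diff h e\<bar>) + (\<Sum>e\<in>{a..b}. \<bar>second_diff g e\<bar>)
      + d / L * (\<Sum>e\<in>{a..b}. \<bar>h (e + 1) - h e\<bar>) + d / L * (\<Sum>e\<in>{a..b}. \<bar>h (e - 1 + 1) - h (e - 1)\<bar>)"
    by (simp add: sum.distrib sum_distrib_left)
  also have "(\<Sum>e\<in>{a..b}. \<bar>h (e - 1 + 1) - h (e - 1)\<bar>) = (\<Sum>e\<in>{a-1..b-1}. \<bar>h (e + 1) - h e\<bar>)"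
    using sum_shift_int[of "\<lambda>e. \<bar>h (e + 1) - h e\<bar>" "-1" a b] by simp
  also have "(\<Sum>e\<in>{a..b}. \<bar>second_diff h e\<bar>) + (\<Sum>e\<in>{a..b}. \<bar>second_diff g e\<bar>)
      + d / L * (\<Sum>e\<in>{a..b}. \<bar>h (e + 1) - h e\<bar>) + d / L * (\<Sum>e\<in>{a-1..b-1}. \<bar>h (e + 1) - h e\<bar>)
      \<le> 1 / W + 4 * d / L + d / L * 1 + d / L * 1"
    unfolding g_def h_def using assms
    by (intro add_mono mult_left_mono sum_second_diff_ramp_le sum_second_diff_tent_le sum_ramp_step_le) auto
  finally show ?thesis unfolding g_def h_def by (simp add: algebra_simps add_divide_distrib)
qed

section \<open>Inverse squares and squared cosecants summed over residues\<close>

lemma sum_inverse_squares_le: "(\<Sum>b\<in>{1..n}. 1 / (real b) ^ 2) \<le> 2"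
proof -
  \<comment> \<open>Strengthened so that the induction telescopes; \<open>max 1 n\<close> gives the
    value 1 at n = 0 as well.\<close>
  have "(\<Sum>b\<in>{1..n}. 1 / (real b) ^ 2) \<le> 2 - 1 / real (max 1 n)"
  proof (induction n)
    case (Suc n)
    show ?case
    proof (cases "n = 0")
      case False
      then have "1 / (real (Suc n)) ^ 2 \<le> 1 / real n - 1 / real (Suc n)"
        by (simp add: divide_simps power2_eq_square)
      then show ?thesis using Suc False by (simp add: max_def split: if_splits)
    qed simp
  qed simp
  also have "\<dots> \<le> 2" by simp
  finally show ?thesis .
qed

text \<open>The reciprocal of the factor in \<open>norm_sum_expi_le\<close>. At integers division by
  zero makes it 0, so a bound through it has to exclude integral t.\<close>

definition csc_sq :: "real \<Rightarrow> real" where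
  "csc_sq t = 1 / (4 * (sin (pi * t)) ^ 2)"

lemma csc_sq_nonneg: "csc_sq t \<ge> 0"
  by (simp add: csc_sq_def)

lemma csc_sq_add_int: "csc_sq (t + of_int n) = csc_sq t"
proof -
  have "(sin (pi * of_int n)) = 0" "(cos (pi * of_int n)) ^ 2 = 1"
    using sin_times_pi_eq_0[of "of_int n"] sin_cos_squared_add[of "pi * of_int n"]
    by (simp_all add: mult.commute)
  then show ?thesis
    by (simp add: csc_sq_def distrib_left sin_add power_mult_distrib)
qed

lemma csc_sq_le:
  assumes "\<bar>t\<bar> \<le> 1 / 2" "t \<noteq> 0"
  shows "csc_sq t \<le> 1 / (16 * t ^ 2)"
proof -
  have "(2 * \<bar>t\<bar>) ^ 2 \<le> \<bar>sin (pi * t)\<bar> ^ 2"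
    by (intro power_mono abs_sin_pi_ge assms) auto
  then have "16 * t ^ 2 \<le> 4 * (sin (pi * t)) ^ 2" by (simp add: power_mult_distrib)
  then show ?thesis
    unfolding csc_sq_def using assms by (intro divide_left_mono mult_pos_pos) (auto intro: less_le_trans[of _ "16 * t ^ 2"])
qed

text \<open>Periodicity moves b > q / 2 to - (q - b), where the bound by inverse squares applies.
  Bounding each term by both contributions gives 2 + 2 in place of a case split in the sum.\<close>

lemma sum_csc_sq_le: "(\<Sum>b\<in>{1..<q}. csc_sq (real b / real q)) \<le> (real q) ^ 2 / 4"
proof -
  have step: "csc_sq (real b / real q) \<le> (real q) ^ 2 / 16 * (1 / (real b) ^ 2 + 1 / (real (q - b)) ^ 2)"
    if b: "b \<in> {1..<q}" for b
  proof (cases "2 * b \<le> q")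
    case True
    then have "csc_sq (real b / real q) \<le> 1 / (16 * (real b / real q) ^ 2)"
      using b by (intro csc_sq_le) (auto simp: field_simps)
    also have "\<dots> = (real q) ^ 2 / 16 * (1 / (real b) ^ 2)"
      by (simp add: power_divide)
    also have "\<dots> \<le> (real q) ^ 2 / 16 * (1 / (real b) ^ 2 + 1 / (real (q - b)) ^ 2)"
      by (intro mult_left_mono) auto
    finally show ?thesis .
  next
    case False
    define t where "t = - (real (q - b) / real q)"
    have "csc_sq (real b / real q) = csc_sq (t + of_int 1)"
      using b by (simp add: t_def of_nat_diff diff_divide_distrib)
    also have "\<dots> = csc_sq t" by (rule csc_sq_add_int)
    also have "\<dots> \<le> 1 / (16 * t ^ 2)"
      using b False by (intro csc_sq_le) (auto simp: t_def field_simps of_nat_diff)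
    also have "\<dots> = (real q) ^ 2 / 16 * (1 / (real (q - b)) ^ 2)"
      by (simp add: t_def power_divide)
    also have "\<dots> \<le> (real q) ^ 2 / 16 * (1 / (real b) ^ 2 + 1 / (real (q - b)) ^ 2)"
      by (intro mult_left_mono) auto
    finally show ?thesis .
  qed
  have sq: "(\<Sum>b\<in>{1..<q}. 1 / (real b) ^ 2) \<le> 2"
    by (rule order_trans[OF sum_mono2 sum_inverse_squares_le[of q]]) auto
  have "(\<Sum>b\<in>{1..<q}. csc_sq (real b / real q))
      \<le> (\<Sum>b\<in>{1..<q}. (real q) ^ 2 / 16 * (1 / (real b) ^ 2 + 1 / (real (q - b)) ^ 2))"
    by (intro sum_mono step)
  also have "\<dots> = (real q) ^ 2 / 16 * ((\<Sum>b\<in>{1..<q}. 1 / (real b) ^ 2) + (\<Sum>b\<in>{1..<q}. 1 / (real (q - b)) ^ 2))"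
    unfolding sum_distrib_left[symmetric] sum.distrib ..
  also have "(\<Sum>b\<in>{1..<q}. 1 / (real (q - b)) ^ 2) = (\<Sum>b\<in>{1..<q}. 1 / (real b) ^ 2)"
    by (rule sum.reindex_bij_witness[where i = "\<lambda>b. q - b" and j = "\<lambda>b. q - b"]) auto
  also have "(real q) ^ 2 / 16 * ((\<Sum>b\<in>{1..<q}. 1 / (real b) ^ 2) + (\<Sum>b\<in>{1..<q}. 1 / (real b) ^ 2))
      \<le> (real q) ^ 2 / 16 * (2 + 2)"
    using sq by (intro mult_left_mono add_mono) auto
  finally show ?thesis by simp
qed

lemma csc_sq_cong_mod:
  fixes A :: int
  assumes "q > 0" "[A = B] (mod int q)"
  shows "csc_sq (of_int A / real q) = csc_sq (of_int B / real q)"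
proof -
  obtain k where "A = B + int q * k" using assms(2) by (metis cong_iff_lin cong_sym)
  then have "of_int A / real q = of_int B / real q + of_int k"
    using assms by (simp add: field_simps)
  then show ?thesis by (simp only: csc_sq_add_int)
qed

text \<open>Multiplication by A permutes the nonzero residues mod q.\<close>

lemma sum_csc_sq_coprime_le:
  fixes A :: int
  assumes "coprime A (int q)" "q > 0"
  shows "(\<Sum>b\<in>{1..<q}. csc_sq (of_int A * real b / real q)) \<le> (real q) ^ 2 / 4"
proof -
  define f where "f b = nat ((A * int b) mod int q)" for b
  have f_int: "int (f b) = (A * int b) mod int q" for b
    using assms by (simp add: f_def)
  have inj: "inj_on f {1..<q}"
  proof (rule inj_onI)
    fix b c assume bc: "b \<in> {1..<q}" "c \<in> {1..<q}" "f b = f c"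
    then have "[A * int b = A * int c] (mod int q)" using f_int by (metis cong_def)
    then have "[int b = int c] (mod int q)" using assms(1) by (simp add: cong_mult_lcancel)
    then show "b = c" using bc by (simp add: cong_def)
  qed
  have sub: "f ` {1..<q} \<subseteq> {1..<q}"
  proof
    fix x assume "x \<in> f ` {1..<q}"
    then obtain b where b: "b \<in> {1..<q}" "x = f b" by auto
    have "f b < q" using f_int[of b] assms by (metis of_nat_less_iff of_nat_0_less_iff pos_mod_bound)
    moreover have "f b \<noteq> 0"
    proof
      assume "f b = 0"
      then have "int q dvd A * int b" using f_int[of b] by (simp add: dvd_eq_mod_eq_0)
      then have "int q dvd int b" using assms(1) by (metis coprime_dvd_mult_right_iff coprime_commute)
      then show False using b by (simp add: nat_dvd_not_less)
    qed
    ultimately show "x \<in> {1..<q}" using b by simp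
  qed
  have im: "f ` {1..<q} = {1..<q}"
    by (rule endo_inj_surj[OF _ sub inj]) simp
  have "csc_sq (of_int A * real b / real q) = csc_sq (real (f b) / real q)" for b
  proof -
    have "csc_sq (of_int (A * int b) / real q) = csc_sq (of_int (int (f b)) / real q)"
      by (rule csc_sq_cong_mod[OF assms(2)]) (simp add: f_int cong_def)
    then show ?thesis by simp
  qed
  then have "(\<Sum>b\<in>{1..<q}. csc_sq (of_int A * real b / real q)) = (\<Sum>b\<in>{1..<q}. csc_sq (real (f b) / real q))"
    by simp
  also have "\<dots> = (\<Sum>b\<in>f ` {1..<q}. csc_sq (real b / real q))"
    unfolding sum.reindex[OF inj] by simp
  also have "\<dots> \<le> (real q) ^ 2 / 4" unfolding im by (rule sum_csc_sq_le)
  finally show ?thesis .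
qed

lemma sum_csc_sq_nondvd_le:
  fixes A :: int
  assumes "coprime A (int q)" "q > 0"
  shows "(\<Sum>d | d \<in> {1..D} \<and> \<not> q dvd d. csc_sq (of_int A * real d / real q))
           \<le> (real D / real q + 1) * ((real q) ^ 2 / 4)"
proof -
  \<comment> \<open>With the value 0 at multiples of q the summand is periodic on all of the
    naturals, and {1..D} is covered by D div q + 1 full periods.\<close>
  define f where "f d = (if q dvd d then 0 else csc_sq (of_int A * real d / real q))" for d
  have per: "f (m * q + b) = f b" for m b
  proof -
    have "csc_sq (of_int (A * int (m * q + b)) / real q) = csc_sq (of_int (A * int b) / real q)"
      by (rule csc_sq_cong_mod[OF assms(2)]) (simp add: cong_iff_dvd_diff algebra_simps)
    then show ?thesis by (simp add: f_def dvd_add_right_iff)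
  qed
  have f0: "f d \<ge> 0" for d by (simp add: f_def csc_sq_nonneg)
  define J where "J = D div q + 1"
  have DJ: "D < J * q"
    using assms(2) by (metis J_def Suc_eq_plus1 dividend_less_div_times mult_Suc add.commute)
  have "(\<Sum>d | d \<in> {1..D} \<and> \<not> q dvd d. csc_sq (of_int A * real d / real q)) = (\<Sum>d\<in>{1..D}. f d)"
    unfolding f_def by (rule sum.mono_neutral_cong_left) auto
  also have "\<dots> \<le> (\<Sum>d<J * q. f d)"
    using DJ f0 by (intro sum_mono2) auto
  also have "\<dots> = (\<Sum>m<J. \<Sum>d\<in>{m * q..<m * q + q}. f d)"
    by (rule sum.nat_group[symmetric])
  also have "\<dots> = (\<Sum>m<J. \<Sum>d\<in>{0..<q}. f d)"
  proof (rule sum.cong[OF refl])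
    fix m
    have "(\<Sum>d\<in>{m * q..<m * q + q}. f d) = (\<Sum>d\<in>{0..<q}. f (d + m * q))"
      using sum.shift_bounds_nat_ivl[of f 0 "m * q" q] by (simp add: add.commute)
    then show "(\<Sum>d\<in>{m * q..<m * q + q}. f d) = (\<Sum>d\<in>{0..<q}. f d)"
      using per[of m] by (simp add: add.commute)
  qed
  also have "(\<Sum>d\<in>{0..<q}. f d) = (\<Sum>b\<in>{1..<q}. csc_sq (of_int A * real b / real q))"
  proof -
    have "(\<Sum>d\<in>{0..<q}. f d) = (\<Sum>d\<in>{1..<q}. f d)"
      by (rule sum.mono_neutral_right) (auto simp: f_def Suc_le_eq)
    also have "\<dots> = (\<Sum>b\<in>{1..<q}. csc_sq (of_int A * real b / real q))"
      by (rule sum.cong) (auto simp: f_def nat_dvd_not_less)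
    finally show ?thesis .
  qed
  also have "(\<Sum>m<J. \<Sum>b\<in>{1..<q}. csc_sq (of_int A * real b / real q)) \<le> (\<Sum>m<J. (real q) ^ 2 / 4)"
    by (intro sum_mono sum_csc_sq_coprime_le assms)
  also have "\<dots> = real J * ((real q) ^ 2 / 4)" by simp
  also have "\<dots> \<le> (real D / real q + 1) * ((real q) ^ 2 / 4)"
    by (intro mult_right_mono) (simp_all add: J_def of_nat_div_le_of_nat)
  finally show ?thesis .
qed

text \<open>\<open>divisor_tau m\<close> counts the factorizations m = d e. The double sum may run
  over a full square because g vanishes at products beyond X.\<close>

lemma sum_divisor_tau:
  fixes g :: "nat \<Rightarrow> complex"
  assumes g0: "\<And>m. m > X \<Longrightarrow> g m = 0"
  shows "(\<Sum>m\<in>{1..X}. of_nat (divisor_tau m) * g m) = (\<Sum>d\<in>{1..X}. \<Sum>e\<in>{1..X}. g (d * e))"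
proof -
  have factors_le: "b \<le> X \<and> k \<le> X" if "0 < b" "0 < k" "b * k \<le> X" for b k
  proof -
    have "b * 1 \<le> b * k" "1 * k \<le> b * k" using that by (intro mult_le_mono; simp)+
    then show ?thesis using that by linarith
  qed
  have "(\<Sum>m\<in>{1..X}. of_nat (divisor_tau m) * g m) = (\<Sum>m\<in>{1..X}. \<Sum>d | d dvd m. g m)"
    by (simp add: divisor_tau_def)
  also have "\<dots> = (\<Sum>(m, d)\<in>(SIGMA m:{1..X}. {d. d dvd m}). g m)"
    by (rule sum.Sigma) (auto intro: finite_divisors_nat)
  also have "\<dots> = (\<Sum>(d, e) | (d, e) \<in> {1..X} \<times> {1..X} \<and> d * e \<le> X. g (d * e))"
    by (rule sum.reindex_bij_witness[where i = "\<lambda>(d, e). (d * e, d)" and j = "\<lambda>(m, d). (d, m div d)"])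
       (auto elim!: dvdE simp: Suc_le_eq dest: factors_le)
  also have "\<dots> = (\<Sum>(d, e)\<in>{1..X} \<times> {1..X}. g (d * e))"
    by (rule sum.mono_neutral_left) (use g0 in \<open>force simp: not_le[symmetric]\<close>)+
  finally show ?thesis by (simp add: sum.cartesian_product)
qed

section \<open>The smoothed divisor sum at a rational frequency\<close>

text \<open>The M(k) of the overview. For k <= N^2 the weight vanishes beyond 4 N^2, so the range
  loses nothing.\<close>

definition smooth_sum :: "nat \<Rightarrow> nat \<Rightarrow> real \<Rightarrow> complex" where
  "smooth_sum N k r = (\<Sum>m\<in>{1..4 * N ^ 2}. of_real (tent (real N ^ 2) (real m - real k)) *
      (of_nat (divisor_tau m) * expi (r * real m)))"

definition hyperbola_weight :: "nat \<Rightarrow> nat \<Rightarrow> nat \<Rightarrow> int \<Rightarrow> real" where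
  "hyperbola_weight N k d e = tent (real N ^ 2) (real d * of_int e - real k) * ramp (real N) (of_int e - real d)"

definition hyperbola_sum :: "nat \<Rightarrow> nat \<Rightarrow> real \<Rightarrow> nat \<Rightarrow> complex" where
  "hyperbola_sum N k r d = (\<Sum>e\<in>{1..4 * N ^ 2}. of_real (hyperbola_weight N k d (int e)) * expi (r * real d * real e))"

text \<open>The ramp is a smooth cut-off for Dirichlet's hyperbola method: ramp (e - d) + ramp (d - e) = 1.\<close>

lemma smooth_sum_eq_hyperbola:
  assumes "N > 0" "k \<le> N ^ 2"
  shows "smooth_sum N k r = 2 * (\<Sum>d\<in>{1..4 * N ^ 2}. hyperbola_sum N k r d)"
proof -
  define X where "X = 4 * N ^ 2"
  define g where "g m = of_real (tent (real N ^ 2) (real m - real k)) * expi (r * real m)" for m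
  define h where "h d e = of_real (ramp (real N) (real e - real d)) * g (d * e)" for d e
  have g0: "g m = 0" if "m > X" for m
  proof -
    have "real m \<ge> 4 * real N ^ 2" "real k \<le> real N ^ 2"
      using that assms by (simp_all add: X_def flip: of_nat_power)
    then have "3 * real N ^ 2 \<le> real m - real k" by linarith
    then show ?thesis using assms by (simp add: g_def tent_eq_0)
  qed
  have split: "g (d * e) = h d e + h e d" for d e
  proof -
    have "ramp (real N) (real e - real d) + ramp (real N) (real d - real e) = 1"
      using ramp_add_minus[of "real N" "real e - real d"] assms by simp
    then have "(of_real (ramp (real N) (real e - real d)) + of_real (ramp (real N) (real d - real e))) * g (d * e) = g (d * e)"
      by (simp flip: of_real_add)
    then show ?thesis by (simp add: h_def distrib_right mult.commute[of e d])
  qed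
  have "smooth_sum N k r = (\<Sum>m\<in>{1..X}. of_nat (divisor_tau m) * g m)"
    unfolding smooth_sum_def X_def g_def by (intro sum.cong) (auto simp: mult_ac)
  also have "\<dots> = (\<Sum>d\<in>{1..X}. \<Sum>e\<in>{1..X}. g (d * e))" by (rule sum_divisor_tau[OF g0])
  also have "\<dots> = (\<Sum>d\<in>{1..X}. \<Sum>e\<in>{1..X}. h d e) + (\<Sum>d\<in>{1..X}. \<Sum>e\<in>{1..X}. h e d)"
    unfolding split sum.distrib ..
  also have "(\<Sum>d\<in>{1..X}. \<Sum>e\<in>{1..X}. h e d) = (\<Sum>d\<in>{1..X}. \<Sum>e\<in>{1..X}. h d e)" by (rule sum.swap)
  also have "(\<Sum>d\<in>{1..X}. \<Sum>e\<in>{1..X}. h d e) = (\<Sum>d\<in>{1..X}. hyperbola_sum N k r d)"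
    unfolding hyperbola_sum_def X_def h_def g_def hyperbola_weight_def
    by (intro sum.cong refl) (simp add: mult_ac)
  finally show ?thesis by (simp add: X_def)
qed

lemma hyperbola_weight_nonneg: "N > 0 \<Longrightarrow> hyperbola_weight N k d e \<ge> 0"
  by (simp add: hyperbola_weight_def tent_nonneg ramp_nonneg)

text \<open>If d > 3 N, the ramp forces e > d - N >= 2 N, and then d e - k >= 5 N^2 lies beyond the
  tent.\<close>

lemma hyperbola_sum_eq_0:
  assumes "N > 0" "k \<le> N ^ 2" "d > 3 * N"
  shows "hyperbola_sum N k r d = 0"
  unfolding hyperbola_sum_def
proof (rule sum.neutral, rule ballI)
  fix e :: nat
  have k: "real k \<le> real N ^ 2" using assms(2) by (simp flip: of_nat_power)
  have "hyperbola_weight N k d (int e) = 0"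
  proof (cases "real e - real d \<le> - real N")
    case False
    then have "2 * real N \<le> real e" "3 * real N \<le> real d" using assms(3) by linarith+
    then have "(3 * real N) * (2 * real N) \<le> real d * real e" by (intro mult_mono) auto
    then have "real d * real e - real k \<ge> 3 * real N ^ 2"
      using k zero_le_power2[of "real N"] by (simp add: power2_eq_square)
    then show ?thesis using assms by (simp add: hyperbola_weight_def tent_eq_0)
  qed (use assms in \<open>simp add: hyperbola_weight_def ramp_eq_0\<close>)
  then show "of_real (hyperbola_weight N k d (int e)) * expi (r * real d * real e) = 0" by simp
qed

lemma norm_hyperbola_sum_le:
  fixes A :: int
  assumes "N > 0" "k \<le> N ^ 2" "d \<ge> 1" "d \<le> 3 * N" "\<not> int q dvd A * int d" "q > 0"
  shows "norm (hyperbola_sum N k (of_int A / real q) d) \<le> 19 / real N * csc_sq (of_int A * real d / real q)"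
proof -
  define t where "t = of_int A * real d / real q"
  define L where "L = real N ^ 2"
  have L: "L > 0" "real k \<le> L" using assms by (simp_all add: L_def flip: of_nat_power)
  have int_sum: "(\<Sum>e\<in>{1..X}. G (int e)) = (\<Sum>e\<in>{1..int X}. G e)" for G :: "int \<Rightarrow> complex" and X
    by (rule sum.reindex_bij_witness[where i = nat and j = int]) auto
  have "hyperbola_sum N k (of_int A / real q) d
      = (\<Sum>e\<in>{1..4 * N ^ 2}. (\<lambda>e. of_real (hyperbola_weight N k d e) * expi (t * of_int e)) (int e))"
    unfolding hyperbola_sum_def t_def by (simp add: mult_ac)
  also have "\<dots> = (\<Sum>e\<in>{1..int (4 * N ^ 2)}. of_real (hyperbola_weight N k d e) * expi (t * of_int e))"
    by (rule int_sum)
  finally have eq: "hyperbola_sum N k (of_int A / real q) d = \<dots>" .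
  have supp: "hyperbola_weight N k d e = 0" if "e < 1 \<or> int (4 * N ^ 2) < e" for e
  proof -
    have "real d * of_int e - real k \<le> L \<or> 3 * L \<le> real d * of_int e - real k"
      using that
    proof
      assume "e < 1"
      then have "real d * of_int e \<le> 0" by (intro mult_nonneg_nonpos) auto
      then show ?thesis using L by linarith
    next
      assume "int (4 * N ^ 2) < e"
      then have "real_of_int (int (4 * N ^ 2)) \<le> of_int e" by linarith
      then have "1 * (4 * L) \<le> real d * of_int e"
        using assms L by (intro mult_mono) (auto simp: L_def)
      then show ?thesis using L by linarith
    qed
    then show ?thesis using L by (simp add: hyperbola_weight_def L_def[symmetric] tent_eq_0)
  qed
  have "norm (hyperbola_sum N k (of_int A / real q) d) * (4 * (sin (pi * t)) ^ 2)
      \<le> (\<Sum>e\<in>{1-1..int (4 * N ^ 2)+1}. \<bar>second_diff (hyperbola_weight N k d) e\<bar>)"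
    unfolding eq by (rule norm_sum_expi_le) (use supp in auto)
  also have "\<dots> \<le> 6 * real d / L + 1 / real N"
    unfolding hyperbola_weight_def L_def[symmetric]
    by (rule sum_second_diff_tent_ramp_le) (use L assms in auto)
  \<comment> \<open>The bound d <= 3 N turns 6 d / N^2 into 18 / N.\<close>
  also have "\<dots> \<le> 19 / real N"
  proof -
    have "real d \<le> 3 * real N" using assms(4) by linarith
    then show ?thesis using assms(1) by (simp add: L_def field_simps power2_eq_square)
  qed
  finally have main: "norm (hyperbola_sum N k (of_int A / real q) d) * (4 * (sin (pi * t)) ^ 2) \<le> 19 / real N" .
  \<comment> \<open>Needed to divide: a zero would make A d / q an integer.\<close>
  have "sin (pi * t) \<noteq> 0"
  proof
    assume "sin (pi * t) = 0"
    then obtain n :: int where "t = of_int n" by (auto simp: sin_zero_iff_int2)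
    then have "of_int A * real d = real q * of_int n" using assms(6) by (simp add: t_def field_simps)
    then have "real_of_int (A * int d) = real_of_int (int q * n)" by simp
    then have "A * int d = int q * n" by linarith
    then show False using assms(5) by simp
  qed
  then show ?thesis using main by (simp add: csc_sq_def t_def[symmetric] pos_le_divide_eq flip: divide_divide_eq_left)
qed

lemma hyperbola_sum_of_dvd:
  fixes A :: int
  assumes "q dvd d" "q > 0"
  shows "hyperbola_sum N k (of_int A / real q) d = of_real (\<Sum>e\<in>{1..4 * N ^ 2}. hyperbola_weight N k d (int e))"
proof -
  obtain j where "d = q * j" using assms by blast
  then have "of_int A / real q * real d * real e = of_int (A * int j * int e)" for e
    using assms(2) by simp
  then show ?thesis unfolding hyperbola_sum_def by (simp only: expi_of_int) simp
qed

text \<open>Consider the e for which d e - k lies within N^2 / 2 of the peak. There the tent is at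
  least 1/2, and e >= 3 N / 2 >= N + d puts the ramp at 1. There are at least N^2 / d - 1 such e,
  which is at least half of N^2 / d.\<close>

lemma sum_hyperbola_weight_ge:
  assumes "N > 0" "k \<le> N ^ 2" "d \<ge> 1" "2 * d \<le> N"
  shows "(\<Sum>e\<in>{1..4 * N ^ 2}. hyperbola_weight N k d (int e)) \<ge> real N ^ 2 / (4 * real d)"
proof -
  define L where "L = real N ^ 2"
  define a where "a = nat \<lceil>(3 / 2 * L + real k) / real d\<rceil>"
  define b where "b = nat \<lfloor>(5 / 2 * L + real k) / real d\<rfloor>"
  have L: "L > 0" "real k \<le> L" using assms by (simp_all add: L_def flip: of_nat_power)
  have d: "real d \<ge> 1" "2 * real d \<le> real N" using assms by linarith+
  have Nd: "2 * real N * real d \<le> L"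
    using mult_left_mono[OF d(2), of "real N"] by (simp add: L_def power2_eq_square)
  have a1: "(3 / 2 * L + real k) / real d \<le> real a" unfolding a_def by linarith
  have a2: "real a \<le> (3 / 2 * L + real k) / real d + 1"
    using L d unfolding a_def by (simp add: ceiling_correct of_nat_nat)
  have b1: "real b \<le> (5 / 2 * L + real k) / real d"
    using L d unfolding b_def by (simp add: of_nat_nat)
  have b2: "(5 / 2 * L + real k) / real d - 1 \<le> real b" unfolding b_def by linarith
  have ge: "hyperbola_weight N k d (int e) \<ge> 1 / 2" if e: "e \<in> {a..b}" for e
  proof -
    have "(3 / 2 * L + real k) / real d \<le> real e" "real e \<le> (5 / 2 * L + real k) / real d"
      using a1 b1 e by (auto intro: order_trans)
    then have e2: "3 / 2 * L + real k \<le> real d * real e" "real d * real e \<le> 5 / 2 * L + real k"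
      using d by (simp_all add: field_simps)
    then have t: "tent L (real d * real e - real k) \<ge> 1 / 2"
      using L by (intro tent_ge_half abs_leI) linarith+
    have "real d * (3 * real N) \<le> real d * (2 * real e)" using e2 Nd by (simp add: algebra_simps)
    then have "3 * real N \<le> 2 * real e" using d by (simp add: mult_le_cancel_left)
    then have "ramp (real N) (real e - real d) = 1"
      using d assms by (intro ramp_eq_1) auto
    then show ?thesis using t by (simp add: hyperbola_weight_def L_def)
  qed
  have a_pos: "a \<ge> 1"
  proof -
    have "(3 / 2 * L + real k) / real d > 0" using L d by (intro divide_pos_pos add_pos_nonneg) auto
    then show ?thesis using a1 by linarith
  qed
  have b_le: "b \<le> 4 * N ^ 2"
  proof -
    have "(5 / 2 * L + real k) / real d \<le> (5 / 2 * L + real k) / 1"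
      using d L by (intro divide_left_mono) auto
    then have "real b \<le> 4 * L" using b1 L unfolding div_by_1 by linarith
    then have "real b \<le> real (4 * N ^ 2)" by (simp add: L_def)
    then show ?thesis by linarith
  qed
  have "L / real d \<le> real b + 1 + (1 - real a)"
  proof -
    have "(5 / 2 * L + real k) / real d - (3 / 2 * L + real k) / real d = L / real d"
      by (simp flip: diff_divide_distrib)
    then show ?thesis using a2 b2 by linarith
  qed
  then have card: "L / real d - 1 \<le> real (card {a..b})" by (simp add: of_nat_diff)
  have "1 * real d \<le> real N * real d" using assms(1) by (intro mult_right_mono) auto
  then have "2 * real d \<le> L" using Nd by linarith
  then have "2 \<le> L / real d" using d by (simp add: pos_le_divide_eq)
  then have "L / real d * (1 / 4) \<le> real (card {a..b}) * (1 / 2)" using card by (simp add: field_simps)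
  also have "\<dots> \<le> (\<Sum>e\<in>{a..b}. hyperbola_weight N k d (int e))"
    using sum_bounded_below[of "{a..b}" "1/2" "\<lambda>e. hyperbola_weight N k d (int e)"] ge by simp
  also have "\<dots> \<le> (\<Sum>e\<in>{1..4 * N ^ 2}. hyperbola_weight N k d (int e))"
    using a_pos b_le assms(1) by (intro sum_mono2) (auto simp: hyperbola_weight_nonneg)
  finally show ?thesis by (simp add: L_def)
qed

text \<open>The multiples d of q have constant phase 1 and form the real main term P, a harmonic sum
  over d / q. All other d go into E, where the cosecant sums apply.\<close>

lemma smooth_sum_approx:
  fixes A :: int
  assumes "coprime A (int q)" "q > 0" "30 * q \<le> N" "k \<le> N ^ 2"
  obtains P :: real and E :: complex where "smooth_sum N k (of_int A / real q) = of_real P + E"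
    "P \<ge> real N ^ 2 / (2 * real q) * ln (real N / (2 * real q))" "norm E \<le> 40 * real q"
proof -
  define X where "X = 4 * N ^ 2"
  define S where "S = hyperbola_sum N k (of_int A / real q)"
  define W where "W d = (\<Sum>e\<in>{1..4 * N ^ 2}. hyperbola_weight N k d (int e))" for d
  define P where "P = 2 * (\<Sum>d | d \<in> {1..X} \<and> q dvd d. W d)"
  define E where "E = 2 * (\<Sum>d | d \<in> {1..X} \<and> \<not> q dvd d. S d)"
  have N: "N > 0" using assms by simp
  have W0: "W d \<ge> 0" for d unfolding W_def using N by (intro sum_nonneg hyperbola_weight_nonneg)
  have "(\<Sum>d\<in>{1..X}. S d) = (\<Sum>d | d \<in> {1..X} \<and> q dvd d. S d) + (\<Sum>d | d \<in> {1..X} \<and> \<not> q dvd d. S d)"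
    by (subst sum.union_disjoint[symmetric]) (auto intro!: sum.cong)
  moreover have "(\<Sum>d | d \<in> {1..X} \<and> q dvd d. S d) = of_real (\<Sum>d | d \<in> {1..X} \<and> q dvd d. W d)"
    unfolding of_real_sum S_def W_def using assms(2) by (intro sum.cong) (auto simp: hyperbola_sum_of_dvd)
  ultimately have "smooth_sum N k (of_int A / real q) = of_real P + E"
    unfolding smooth_sum_eq_hyperbola[OF N assms(4)] by (simp add: P_def E_def S_def X_def distrib_left)
  moreover have "P \<ge> real N ^ 2 / (2 * real q) * ln (real N / (2 * real q))"
  proof -
    \<comment> \<open>The multiples d = q j with 2 d <= N, for which the lower bound on the weights
      is available.\<close>
    define J where "J = N div (2 * q)"
    have "N < (J + 1) * (2 * q)"
      unfolding J_def using assms(2) by (metis Suc_eq_plus1 dividend_less_div_times mult_Suc add.commute mult_pos_pos zero_less_numeral)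
    then have "real N < real ((J + 1) * (2 * q))" by (simp only: of_nat_less_iff)
    then have "real N / (2 * real q) \<le> real J + 1" using assms(2) by (simp add: field_simps)
    then have "ln (real N / (2 * real q)) \<le> ln (real J + 1)" using N assms(2) by simp
    also have "\<dots> \<le> harm J" by (rule ln_le_harm)
    finally have "real N ^ 2 / (2 * real q) * ln (real N / (2 * real q)) \<le> real N ^ 2 / (2 * real q) * harm J"
      by (intro mult_left_mono) auto
    also have "\<dots> = 2 * (\<Sum>j\<in>{1..J}. real N ^ 2 / (4 * real (q * j)))"
      unfolding harm_def sum_distrib_left by (intro sum.cong) (auto simp: field_simps)
    also have "\<dots> \<le> 2 * (\<Sum>j\<in>{1..J}. W (q * j))"
    proof (intro mult_left_mono sum_mono)
      fix j assume j: "j \<in> {1..J}"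
      have "2 * (q * j) \<le> 2 * (q * J)" using j by simp
      also have "\<dots> \<le> N" unfolding J_def by (metis mult.assoc mult.commute div_times_less_eq_dividend)
      finally show "real N ^ 2 / (4 * real (q * j)) \<le> W (q * j)"
        unfolding W_def using j assms N by (intro sum_hyperbola_weight_ge) auto
    qed simp
    also have "(\<Sum>j\<in>{1..J}. W (q * j)) = (\<Sum>d\<in>(\<lambda>j. q * j) ` {1..J}. W d)"
      using assms(2) by (subst sum.reindex) (auto simp: inj_on_def)
    also have "\<dots> \<le> (\<Sum>d | d \<in> {1..X} \<and> q dvd d. W d)"
    proof (rule sum_mono2)
      show "(\<lambda>j. q * j) ` {1..J} \<subseteq> {d. d \<in> {1..X} \<and> q dvd d}"
      proof
        fix d assume "d \<in> (\<lambda>j. q * j) ` {1..J}"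
        then obtain j where j: "1 \<le> j" "j \<le> J" "d = q * j" by auto
        have "q * j \<le> q * J" using j by simp
        also have "\<dots> \<le> 2 * q * J" by simp
        also have "\<dots> \<le> N" unfolding J_def by (metis mult.commute div_times_less_eq_dividend)
        also have "\<dots> \<le> X" unfolding X_def power2_eq_square by (cases N) auto
        finally show "d \<in> {d. d \<in> {1..X} \<and> q dvd d}" using j assms(2) by simp
      qed
    qed (use W0 in auto)
    finally show ?thesis by (simp add: P_def)
  qed
  moreover have "norm E \<le> 40 * real q"
  proof -
    let ?D = "{d. d \<in> {1..3 * N} \<and> \<not> q dvd d}"
    have "(\<Sum>d | d \<in> {1..X} \<and> \<not> q dvd d. norm (S d)) \<le> (\<Sum>d\<in>?D. norm (S d))"
    proof -
      have "(\<Sum>d | d \<in> {1..X} \<and> \<not> q dvd d. norm (S d)) = (\<Sum>d | d \<in> {1..X} \<and> \<not> q dvd d \<and> d \<le> 3 * N. norm (S d))"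
      proof (rule sum.mono_neutral_right)
        show "\<forall>d\<in>{d. d \<in> {1..X} \<and> \<not> q dvd d} - {d. d \<in> {1..X} \<and> \<not> q dvd d \<and> d \<le> 3 * N}. norm (S d) = 0"
          using hyperbola_sum_eq_0[OF N assms(4)] by (force simp: S_def not_le[symmetric])
      qed auto
      also have "\<dots> \<le> (\<Sum>d\<in>?D. norm (S d))"
        by (rule sum_mono2) auto
      finally show ?thesis .
    qed
    also have "\<dots> \<le> (\<Sum>d\<in>?D. 19 / real N * csc_sq (of_int A * real d / real q))"
    proof (rule sum_mono)
      fix d assume d: "d \<in> ?D"
      then have "\<not> int q dvd A * int d"
        using assms(1) by (metis (no_types, lifting) coprime_commute coprime_dvd_mult_right_iff int_dvd_int_iff mem_Collect_eq)
      then show "norm (S d) \<le> 19 / real N * csc_sq (of_int A * real d / real q)"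
        unfolding S_def using d assms N by (intro norm_hyperbola_sum_le) auto
    qed
    also have "\<dots> = 19 / real N * (\<Sum>d\<in>?D. csc_sq (of_int A * real d / real q))"
      by (simp add: sum_distrib_left)
    also have "\<dots> \<le> 19 / real N * ((real (3 * N) / real q + 1) * ((real q) ^ 2 / 4))"
      using assms by (intro mult_left_mono sum_csc_sq_nondvd_le) auto
    \<comment> \<open>Since q <= N the bracket is at most 4 q, so the sum is at most 19 q; the
      factor 2 of the hyperbola method keeps E below 40 q.\<close>
    also have "\<dots> = 19 / 4 * (3 * real q + real q * (real q / real N))"
      using N assms(2) by (simp add: field_simps power2_eq_square)
    also have "\<dots> \<le> 19 / 4 * (3 * real q + real q * 1)"
      using N assms by (intro mult_left_mono add_mono) (auto simp: field_simps)
    also have "\<dots> \<le> 20 * real q" by simp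
    finally have "(\<Sum>d | d \<in> {1..X} \<and> \<not> q dvd d. norm (S d)) \<le> 20 * real q" .
    then have "norm (\<Sum>d | d \<in> {1..X} \<and> \<not> q dvd d. S d) \<le> 20 * real q"
      by (rule order_trans[OF norm_sum])
    then show ?thesis by (simp add: E_def norm_mult)
  qed
  ultimately show ?thesis using that by blast
qed

section \<open>A weighted large sieve\<close>

text \<open>Rounding x i / \<delta> down sends the points to distinct positive integers f i with x i
  >= \<delta> f i, which reduces the claim to the sum of 1 / n^2.\<close>

lemma sum_inverse_squares_spaced_le:
  fixes x :: "'a \<Rightarrow> real"
  assumes "finite I" "\<delta> > 0" "\<And>i. i \<in> I \<Longrightarrow> x i \<ge> \<delta>"
    "\<And>i j. i \<in> I \<Longrightarrow> j \<in> I \<Longrightarrow> i \<noteq> j \<Longrightarrow> \<bar>x i - x j\<bar> \<ge> \<delta>"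
  shows "(\<Sum>i\<in>I. 1 / (x i) ^ 2) \<le> 2 / \<delta> ^ 2"
proof -
  define f where "f i = nat \<lfloor>x i / \<delta>\<rfloor>" for i
  have f: "real (f i) \<le> x i / \<delta>" "x i / \<delta> < real (f i) + 1" "f i \<ge> 1" if "i \<in> I" for i
  proof -
    have "x i / \<delta> \<ge> 1" using assms that by (simp add: field_simps)
    then have "\<lfloor>x i / \<delta>\<rfloor> \<ge> 1" by linarith
    then show "real (f i) \<le> x i / \<delta>" "x i / \<delta> < real (f i) + 1" "f i \<ge> 1"
      unfolding f_def by linarith+
  qed
  have inj: "inj_on f I"
  proof (rule inj_onI, rule ccontr)
    fix i j assume ij: "i \<in> I" "j \<in> I" "f i = f j" "i \<noteq> j"
    have "\<bar>x i / \<delta> - x j / \<delta>\<bar> < 1" using f[OF ij(1)] f[OF ij(2)] ij(3) by linarith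
    then have "\<bar>x i - x j\<bar> < \<delta>"
      using assms(2) by (simp flip: diff_divide_distrib add: pos_divide_less_eq)
    then show False using assms(4)[OF ij(1,2,4)] by linarith
  qed
  obtain M where M: "f ` I \<subseteq> {1..M}"
  proof -
    obtain M where "\<And>n. n \<in> f ` I \<Longrightarrow> n \<le> M"
      using finite_nat_set_iff_bounded_le[of "f ` I"] assms(1) by auto
    then show ?thesis using f(3) by (intro that[of M]) auto
  qed
  have "(\<Sum>i\<in>I. 1 / (x i) ^ 2) \<le> (\<Sum>i\<in>I. 1 / \<delta> ^ 2 * (1 / (real (f i)) ^ 2))"
  proof (rule sum_mono)
    fix i assume i: "i \<in> I"
    have "\<delta> * real (f i) \<le> x i" using f(1)[OF i] assms(2) by (simp add: field_simps)
    then have "(\<delta> * real (f i)) ^ 2 \<le> (x i) ^ 2" using assms(2) by (intro power_mono) auto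
    then have "1 / (x i) ^ 2 \<le> 1 / (\<delta> * real (f i)) ^ 2"
      using f(3)[OF i] assms(2) by (intro divide_left_mono mult_pos_pos) (auto intro: less_le_trans[of _ "(\<delta> * real (f i)) ^ 2"])
    then show "1 / (x i) ^ 2 \<le> 1 / \<delta> ^ 2 * (1 / (real (f i)) ^ 2)"
      by (simp add: power_mult_distrib)
  qed
  also have "\<dots> = 1 / \<delta> ^ 2 * (\<Sum>n\<in>f ` I. 1 / (real n) ^ 2)"
    unfolding sum.reindex[OF inj] sum_distrib_left by simp
  also have "\<dots> \<le> 1 / \<delta> ^ 2 * (\<Sum>n\<in>{1..M}. 1 / (real n) ^ 2)"
    using M by (intro mult_left_mono sum_mono2) auto
  also have "\<dots> \<le> 1 / \<delta> ^ 2 * 2"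
    by (intro mult_left_mono sum_inverse_squares_le) auto
  finally show ?thesis by simp
qed

text \<open>The quadratic decay, like that of the Fejer kernel, makes the off-diagonal part of the
  large sieve summable. It comes from a total slope change of 4 / N^2 and |sin(pi t)| >= 2
  |t|.\<close>

lemma norm_tent_kernel_le:
  assumes "N > 0" "\<bar>t\<bar> \<le> 1 / 2" "t \<noteq> 0"
  shows "norm (\<Sum>n\<in>{1..3 * int N ^ 2}. of_real (tent (real N ^ 2) (of_int n)) * expi (t * of_int n))
           \<le> 1 / (4 * real N ^ 2 * t ^ 2)" (is "norm ?S \<le> _")
proof -
  define L where "L = real N ^ 2"
  have L: "L > 0" using assms by (simp add: L_def)
  have supp: "tent L (of_int n) = 0" if "n < 1 \<or> 3 * int N ^ 2 < n" for n
  proof -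
    have "real_of_int n \<le> L \<or> 3 * L \<le> real_of_int n"
      using that
    proof
      assume "3 * int N ^ 2 < n"
      then have "real_of_int (3 * int N ^ 2) < of_int n" by linarith
      then show ?thesis by (simp add: L_def)
    next
      assume "n < 1"
      then have "real_of_int n \<le> 0" by simp
      then show ?thesis using L by linarith
    qed
    then show ?thesis using L by (simp add: tent_eq_0)
  qed
  have "norm ?S * (4 * (sin (pi * t)) ^ 2)
      \<le> (\<Sum>n\<in>{1-1..3 * int N ^ 2+1}. \<bar>second_diff (\<lambda>n. tent L (of_int n)) n\<bar>)"
    unfolding L_def[symmetric] by (rule norm_sum_expi_le) (use supp in auto)
  also have "\<dots> \<le> 4 * 1 / L"
    using sum_second_diff_tent_le[OF L, of 1 0 "1-1" "3 * int N ^ 2+1"] by simp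
  finally have main: "norm ?S * (4 * (sin (pi * t)) ^ 2) \<le> 4 / L" by simp
  have "(2 * \<bar>t\<bar>) ^ 2 \<le> \<bar>sin (pi * t)\<bar> ^ 2"
    by (intro power_mono abs_sin_pi_ge assms) auto
  then have "16 * t ^ 2 \<le> 4 * (sin (pi * t)) ^ 2" by (simp add: power_mult_distrib)
  then have "norm ?S * (16 * t ^ 2) \<le> 4 / L"
    by (rule order_trans[OF mult_left_mono main]) auto
  then have "norm ?S \<le> 4 / L / (16 * t ^ 2)"
    using assms(3) by (subst pos_le_divide_eq) auto
  also have "\<dots> = 1 / (4 * real N ^ 2 * t ^ 2)" by (simp add: L_def)
  finally show ?thesis .
qed

lemma tent_kernel_zero_le:
  assumes "N > 0"
  shows "norm (\<Sum>n\<in>{1..3 * int N ^ 2}. of_real (tent (real N ^ 2) (of_int n)) * expi (0 * of_int n))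
           \<le> 2 * real N ^ 2"
proof -
  define L where "L = real N ^ 2"
  have L: "L > 0" using assms by (simp add: L_def)
  have "norm (\<Sum>n\<in>{1..3 * int N ^ 2}. of_real (tent L (of_int n)) * expi (0 * of_int n))
      \<le> (\<Sum>n\<in>{1..3 * int N ^ 2}. tent L (of_int n))"
    by (rule order_trans[OF norm_sum]) (simp add: norm_mult tent_nonneg)
  also have "\<dots> = (\<Sum>n\<in>{int N ^ 2 + 1..3 * int N ^ 2}. tent L (of_int n))"
  proof (rule sum.mono_neutral_right)
    show "\<forall>n\<in>{1..3 * int N ^ 2} - {int N ^ 2 + 1..3 * int N ^ 2}. tent L (of_int n) = 0"
    proof
      fix n assume "n \<in> {1..3 * int N ^ 2} - {int N ^ 2 + 1..3 * int N ^ 2}"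
      then have "n \<le> int N ^ 2" by auto
      then have "real_of_int n \<le> real_of_int (int N ^ 2)" by (simp only: of_int_le_iff)
      then show "tent L (of_int n) = 0" using L by (intro tent_eq_0) (auto simp: L_def)
    qed
  qed auto
  also have "\<dots> \<le> (\<Sum>n\<in>{int N ^ 2 + 1..3 * int N ^ 2}. 1)"
    using L by (intro sum_mono tent_le_1)
  also have "\<dots> = 2 * L" by (simp add: L_def)
  finally show ?thesis by (simp add: L_def)
qed

text \<open>Duality. Expanding V with the conjugates of c as coefficients and using Cauchy-Schwarz
  gives V^2 <= T B, where B is a Hermitian form in the c i with kernel K. Schur's test bounds B by V
  times the largest row sum 3 L: at most 2 L on the diagonal and L / 2 from the points on either
  side.\<close>

lemma tent_large_sieve:
  fixes r :: "'a \<Rightarrow> real" and F :: "int \<Rightarrow> complex"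
  assumes "N > 0" "finite I"
    and spaced: "\<And>i j. i \<in> I \<Longrightarrow> j \<in> I \<Longrightarrow> i \<noteq> j \<Longrightarrow> \<bar>r i - r j\<bar> \<ge> 1 / real N ^ 2"
    and close: "\<And>i j. i \<in> I \<Longrightarrow> j \<in> I \<Longrightarrow> \<bar>r i - r j\<bar> \<le> 1 / 2"
  shows "(\<Sum>i\<in>I. (norm (\<Sum>n\<in>{1..3 * int N ^ 2}. of_real (tent (real N ^ 2) (of_int n)) * expi (r i * of_int n) * F n)) ^ 2)
           \<le> 3 * real N ^ 2 * (\<Sum>n\<in>{1..3 * int N ^ 2}. tent (real N ^ 2) (of_int n) * (norm (F n)) ^ 2)"
proof -
  define L where "L = real N ^ 2"
  have L: "L > 0" using assms by (simp add: L_def)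
  define w where "w n = tent L (of_int n)" for n :: int
  define X where "X = {1..3 * int N ^ 2}"
  define c where "c i = (\<Sum>n\<in>X. of_real (w n) * expi (r i * of_int n) * F n)" for i
  define b where "b n = (\<Sum>i\<in>I. cnj (c i) * expi (r i * of_int n))" for n
  define T where "T = (\<Sum>n\<in>X. w n * (norm (F n)) ^ 2)"
  define B where "B = (\<Sum>n\<in>X. w n * (norm (b n)) ^ 2)"
  define V where "V = (\<Sum>i\<in>I. (norm (c i)) ^ 2)"
  define K where "K t = (\<Sum>n\<in>X. of_real (w n) * expi (t * of_int n))" for t
  have w0: "w n \<ge> 0" for n by (simp add: w_def tent_nonneg)
  have K_le: "(\<Sum>j\<in>I. norm (K (r i - r j))) \<le> 3 * L" if i: "i \<in> I" for i
  proof -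
    \<comment> \<open>The sign \<sigma> selects a side of r i; there the distances are themselves
      spaced by 1 / L and bounded below by 1 / L.\<close>
    have side: "(\<Sum>j\<in>J. norm (K (r i - r j))) \<le> L / 2"
      if J: "J \<subseteq> I" "\<And>j. j \<in> J \<Longrightarrow> \<sigma> * (r j - r i) > 0" "\<sigma> = 1 \<or> \<sigma> = - 1" for J \<sigma>
    proof -
      have eq: "\<bar>r i - r j\<bar> = \<sigma> * (r j - r i)" if "j \<in> J" for j
        using J(2)[OF that] J(3) by auto
      have ne: "i \<noteq> j" if "j \<in> J" for j using J(2)[OF that] by auto
      have "(\<Sum>j\<in>J. norm (K (r i - r j))) \<le> (\<Sum>j\<in>J. 1 / (4 * L) * (1 / (\<sigma> * (r j - r i)) ^ 2))"
      proof (rule sum_mono)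
        fix j assume j: "j \<in> J"
        have "norm (K (r i - r j)) \<le> 1 / (4 * L * (r i - r j) ^ 2)"
          unfolding K_def w_def L_def X_def
          using close[OF i, of j] j J(1) J(2)[OF j] assms(1) by (intro norm_tent_kernel_le) auto
        also have "(r i - r j) ^ 2 = (\<sigma> * (r j - r i)) ^ 2"
          using eq[OF j] by (metis power2_abs)
        finally show "norm (K (r i - r j)) \<le> 1 / (4 * L) * (1 / (\<sigma> * (r j - r i)) ^ 2)" by simp
      qed
      also have "\<dots> = 1 / (4 * L) * (\<Sum>j\<in>J. 1 / (\<sigma> * (r j - r i)) ^ 2)" by (simp add: sum_distrib_left)
      also have "\<dots> \<le> 1 / (4 * L) * (2 / (1 / L) ^ 2)"
      proof (intro mult_left_mono sum_inverse_squares_spaced_le)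
        show "finite J" using J(1) assms(2) by (rule finite_subset)
        show "\<sigma> * (r j - r i) \<ge> 1 / L" if "j \<in> J" for j
          using spaced[OF i, of j] ne[OF that] eq[OF that] that J(1) by (auto simp: L_def)
        show "1 / L \<le> \<bar>\<sigma> * (r j - r i) - \<sigma> * (r k - r i)\<bar>" if "j \<in> J" "k \<in> J" "j \<noteq> k" for j k
        proof -
          have "\<bar>\<sigma> * (r j - r i) - \<sigma> * (r k - r i)\<bar> = \<bar>r j - r k\<bar>" using J(3) by auto
          then show ?thesis using spaced[of j k] that J(1) by (auto simp: L_def)
        qed
      qed (use L in auto)
      also have "\<dots> = L / 2" using L by (simp add: field_simps power2_eq_square)
      finally show ?thesis .
    qed
    define J1 where "J1 = {j \<in> I. r j > r i}"
    define J2 where "J2 = {j \<in> I. r j < r i}"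
    have I: "I = insert i (J1 \<union> J2)"
    proof -
      have "j = i" if "j \<in> I" "r j = r i" for j
        using spaced[OF that(1) i] that(2) L by (auto simp: L_def[symmetric] not_le[symmetric])
      then show ?thesis using i by (force simp: J1_def J2_def)
    qed
    have fin: "finite J1" "finite J2" using assms(2) by (auto simp: J1_def J2_def)
    have disj: "J1 \<inter> J2 = {}" "i \<notin> J1 \<union> J2" by (auto simp: J1_def J2_def)
    have "(\<Sum>j\<in>I. norm (K (r i - r j)))
        = norm (K 0) + ((\<Sum>j\<in>J1. norm (K (r i - r j))) + (\<Sum>j\<in>J2. norm (K (r i - r j))))"
      by (subst I, subst sum.insert) (use fin disj in \<open>auto simp: sum.union_disjoint\<close>)
    also have "\<dots> \<le> 2 * L + (L / 2 + L / 2)"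
    proof (intro add_mono)
      show "norm (K 0) \<le> 2 * L"
        using tent_kernel_zero_le[OF assms(1)] by (simp add: K_def w_def L_def X_def)
      show "(\<Sum>j\<in>J1. norm (K (r i - r j))) \<le> L / 2" by (rule side[of _ 1]) (auto simp: J1_def)
      show "(\<Sum>j\<in>J2. norm (K (r i - r j))) \<le> L / 2" by (rule side[of _ "-1"]) (auto simp: J2_def)
    qed
    finally show ?thesis by simp
  qed
  have V_eq: "of_real V = (\<Sum>n\<in>X. of_real (w n) * F n * b n)"
  proof -
    have "of_real V = (\<Sum>i\<in>I. cnj (c i) * c i)"
      unfolding V_def of_real_sum complex_norm_square by (simp only: mult.commute)
    also have "\<dots> = (\<Sum>i\<in>I. \<Sum>n\<in>X. of_real (w n) * F n * (cnj (c i) * expi (r i * of_int n)))"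
      by (intro sum.cong refl, subst (2) c_def) (simp add: sum_distrib_left mult_ac)
    also have "\<dots> = (\<Sum>n\<in>X. \<Sum>i\<in>I. of_real (w n) * F n * (cnj (c i) * expi (r i * of_int n)))"
      by (rule sum.swap)
    also have "\<dots> = (\<Sum>n\<in>X. of_real (w n) * F n * b n)"
      by (simp add: b_def sum_distrib_left)
    finally show ?thesis .
  qed
  have V_le: "V ^ 2 \<le> T * B"
  proof -
    have V0: "V \<ge> 0" by (simp add: V_def sum_nonneg)
    have "V = norm (complex_of_real V)" using V0 by simp
    also have "\<dots> \<le> (\<Sum>n\<in>X. (sqrt (w n) * norm (F n)) * (sqrt (w n) * norm (b n)))"
      unfolding V_eq using w0 by (intro order_trans[OF norm_sum] sum_mono) (simp add: norm_mult mult_ac flip: real_sqrt_mult_self)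
    finally have "V ^ 2 \<le> (\<Sum>n\<in>X. (sqrt (w n) * norm (F n)) * (sqrt (w n) * norm (b n))) ^ 2"
      using V0 by (intro power_mono) auto
    also have "\<dots> \<le> (\<Sum>n\<in>X. (sqrt (w n) * norm (F n)) ^ 2) * (\<Sum>n\<in>X. (sqrt (w n) * norm (b n)) ^ 2)"
      by (rule Cauchy_Schwarz_ineq_sum)
    also have "\<dots> = T * B" using w0 by (simp add: T_def B_def power_mult_distrib)
    finally show ?thesis .
  qed
  have B_le: "B \<le> 3 * L * V"
  proof -
    have "of_real B = (\<Sum>n\<in>X. of_real (w n) * (b n * cnj (b n)))"
      unfolding B_def of_real_sum of_real_mult complex_norm_square ..
    also have "\<dots> = (\<Sum>n\<in>X. \<Sum>i\<in>I. \<Sum>j\<in>I. cnj (c i) * c j * (of_real (w n) * expi ((r i - r j) * of_int n)))"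
    proof (rule sum.cong[OF refl])
      fix n
      have e: "expi (r i * of_int n) * cnj (expi (r j * of_int n)) = expi ((r i - r j) * of_int n)" for i j
        by (simp add: left_diff_distrib flip: expi_minus expi_add)
      have "b n * cnj (b n) = (\<Sum>i\<in>I. \<Sum>j\<in>I. cnj (c i) * expi (r i * of_int n) * (c j * cnj (expi (r j * of_int n))))"
        by (simp add: b_def sum_product)
      also have "\<dots> = (\<Sum>i\<in>I. \<Sum>j\<in>I. cnj (c i) * c j * (expi (r i * of_int n) * cnj (expi (r j * of_int n))))"
        by (simp only: mult_ac)
      finally show "of_real (w n) * (b n * cnj (b n))
          = (\<Sum>i\<in>I. \<Sum>j\<in>I. cnj (c i) * c j * (of_real (w n) * expi ((r i - r j) * of_int n)))"
        unfolding e by (simp add: sum_distrib_left mult_ac)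
    qed
    also have "\<dots> = (\<Sum>i\<in>I. \<Sum>n\<in>X. \<Sum>j\<in>I. cnj (c i) * c j * (of_real (w n) * expi ((r i - r j) * of_int n)))"
      by (rule sum.swap)
    also have "\<dots> = (\<Sum>i\<in>I. \<Sum>j\<in>I. cnj (c i) * c j * K (r i - r j))"
      unfolding K_def sum_distrib_left by (intro sum.cong refl sum.swap)
    finally have B_eq: "complex_of_real B = (\<Sum>i\<in>I. \<Sum>j\<in>I. cnj (c i) * c j * K (r i - r j))" .
    have K_sym: "norm (K (r i - r j)) = norm (K (r j - r i))" for i j
    proof -
      have "K (r j - r i) = cnj (K (r i - r j))"
        unfolding K_def by (simp flip: expi_minus add: minus_mult_left)
      then show ?thesis by simp
    qed
    have "B \<le> norm (complex_of_real B)" by simp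
    also have "\<dots> \<le> (\<Sum>i\<in>I. \<Sum>j\<in>I. norm (c i) * norm (c j) * norm (K (r i - r j)))"
      unfolding B_eq by (intro order_trans[OF norm_sum] sum_mono) (simp add: norm_mult)
    \<comment> \<open>The arithmetic-geometric mean inequality separates c i from c j; the symmetry
      of the norm of K makes the two halves equal.\<close>
    also have "\<dots> \<le> (\<Sum>i\<in>I. \<Sum>j\<in>I. 1 / 2 * ((norm (c i)) ^ 2 * norm (K (r i - r j))) + 1 / 2 * ((norm (c j)) ^ 2 * norm (K (r i - r j))))"
    proof (intro sum_mono)
      fix i j
      have "norm (c i) * norm (c j) \<le> 1 / 2 * (norm (c i)) ^ 2 + 1 / 2 * (norm (c j)) ^ 2"
        using sum_squares_bound[of "norm (c i)" "norm (c j)"] by simp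
      from mult_right_mono[OF this, of "norm (K (r i - r j))"]
      show "norm (c i) * norm (c j) * norm (K (r i - r j))
          \<le> 1 / 2 * ((norm (c i)) ^ 2 * norm (K (r i - r j))) + 1 / 2 * ((norm (c j)) ^ 2 * norm (K (r i - r j)))"
        by (simp add: distrib_right)
    qed
    also have "\<dots> = 1 / 2 * (\<Sum>i\<in>I. \<Sum>j\<in>I. (norm (c i)) ^ 2 * norm (K (r i - r j)))
        + 1 / 2 * (\<Sum>i\<in>I. \<Sum>j\<in>I. (norm (c j)) ^ 2 * norm (K (r i - r j)))"
      unfolding sum.distrib sum_distrib_left[symmetric] ..
    also have "(\<Sum>i\<in>I. \<Sum>j\<in>I. (norm (c j)) ^ 2 * norm (K (r i - r j)))
        = (\<Sum>i\<in>I. \<Sum>j\<in>I. (norm (c i)) ^ 2 * norm (K (r i - r j)))"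
      by (subst sum.swap) (intro sum.cong refl, simp add: K_sym)
    also have "1 / 2 * (\<Sum>i\<in>I. \<Sum>j\<in>I. (norm (c i)) ^ 2 * norm (K (r i - r j)))
        + 1 / 2 * (\<Sum>i\<in>I. \<Sum>j\<in>I. (norm (c i)) ^ 2 * norm (K (r i - r j)))
        = (\<Sum>i\<in>I. (norm (c i)) ^ 2 * (\<Sum>j\<in>I. norm (K (r i - r j))))"
      by (simp add: sum_distrib_left)
    also have "\<dots> \<le> (\<Sum>i\<in>I. (norm (c i)) ^ 2 * (3 * L))"
      by (intro sum_mono mult_left_mono K_le) auto
    also have "\<dots> = 3 * L * V" by (simp add: V_def sum_distrib_left mult_ac)
    finally show ?thesis .
  qed
  have T0: "T \<ge> 0" using w0 by (simp add: T_def sum_nonneg)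
  have "V * V \<le> (3 * L * T) * V"
  proof -
    have "V * V \<le> T * B" using V_le by (simp add: power2_eq_square)
    also have "\<dots> \<le> T * (3 * L * V)" by (intro mult_left_mono B_le T0)
    finally show ?thesis by (simp add: mult_ac)
  qed
  moreover have "V \<ge> 0" by (simp add: V_def sum_nonneg)
  ultimately have "V \<le> 3 * L * T"
    using T0 L by (cases "V = 0") (auto simp: mult_le_cancel_right)
  then show ?thesis by (simp add: V_def T_def c_def w_def L_def X_def)
qed

section \<open>Window sums tested against rational frequencies\<close>

definition window_sum :: "real \<Rightarrow> nat \<Rightarrow> nat \<Rightarrow> complex" where
  "window_sum \<alpha> K n = (\<Sum>k\<in>{1..K}. of_nat (divisor_tau (n + k)) * expi (\<alpha> * real (n + k)))"

text \<open>The c(r) of the overview. The sum runs over \<open>int\<close>, with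
  \<open>nat n\<close> inside, to have the form required by \<open>tent_large_sieve\<close>.\<close>

definition window_transform :: "real \<Rightarrow> nat \<Rightarrow> nat \<Rightarrow> real \<Rightarrow> complex" where
  "window_transform \<alpha> K N r = (\<Sum>n\<in>{1..3 * int N ^ 2}.
      of_real (tent (real N ^ 2) (of_int n)) * expi ((r - \<alpha>) * of_int n) * window_sum \<alpha> K (nat n))"

lemma smooth_sum_shift:
  assumes "N > 0" "k \<le> N ^ 2"
  shows "smooth_sum N k r = (\<Sum>n\<in>{1..3 * N ^ 2}. of_real (tent (real N ^ 2) (real n)) *
           (of_nat (divisor_tau (n + k)) * expi (r * real (n + k))))"
proof -
  define L where "L = real N ^ 2"
  have L: "L > 0" using assms by (simp add: L_def)
  define G where "G m = of_real (tent L (real m - real k)) * (of_nat (divisor_tau m) * expi (r * real m))" for m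
  have "smooth_sum N k r = (\<Sum>m\<in>{1..4 * N ^ 2}. G m)"
    by (simp add: smooth_sum_def G_def L_def)
  also have "\<dots> = (\<Sum>m\<in>{1 + k..3 * N ^ 2 + k}. G m)"
  proof (rule sum.mono_neutral_right)
    show "\<forall>m\<in>{1..4 * N ^ 2} - {1 + k..3 * N ^ 2 + k}. G m = 0"
    proof
      fix m assume "m \<in> {1..4 * N ^ 2} - {1 + k..3 * N ^ 2 + k}"
      then have "m \<le> k \<or> 3 * N ^ 2 + k \<le> m" by auto
      then have "real m \<le> real k \<or> real (3 * N ^ 2 + k) \<le> real m" by (simp only: of_nat_le_iff)
      then have "real m - real k \<le> L \<or> 3 * L \<le> real m - real k"
        using L by (auto simp: L_def)
      then show "G m = 0" using L by (simp add: G_def tent_eq_0)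
    qed
  qed (use assms in auto)
  also have "\<dots> = (\<Sum>n\<in>{1..3 * N ^ 2}. G (n + k))"
    by (rule sum.shift_bounds_cl_nat_ivl)
  finally show ?thesis by (simp add: G_def L_def)
qed

text \<open>The phases (r - \<alpha>) n + \<alpha> (n + k) and (\<alpha> - r) k + r (n + k) agree.
  This exchanges the frequency \<alpha> inside the window for the rational r and leaves \<alpha> - r
  only in the short sum over k.\<close>

lemma window_transform_eq:
  assumes "N > 0" "K \<le> N ^ 2"
  shows "window_transform \<alpha> K N r = (\<Sum>k\<in>{1..K}. expi ((\<alpha> - r) * real k) * smooth_sum N k r)"
proof -
  define w where "w n = tent (real N ^ 2) (real n)" for n :: nat
  have e: "expi ((r - \<alpha>) * real n) * expi (\<alpha> * real (n + k)) = expi ((\<alpha> - r) * real k) * expi (r * real (n + k))" for n k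
    unfolding expi_add[symmetric] by (simp add: algebra_simps)
  have "window_transform \<alpha> K N r = (\<Sum>n\<in>{1..3 * N ^ 2}. of_real (w n) * expi ((r - \<alpha>) * real n) * window_sum \<alpha> K n)"
  proof -
    have "{1..3 * int N ^ 2} = int ` {1..3 * N ^ 2}" by (simp add: image_int_atLeastAtMost)
    then show ?thesis unfolding window_transform_def w_def by (simp add: sum.reindex)
  qed
  also have "\<dots> = (\<Sum>n\<in>{1..3 * N ^ 2}. \<Sum>k\<in>{1..K}.
      expi ((\<alpha> - r) * real k) * (of_real (w n) * (of_nat (divisor_tau (n + k)) * expi (r * real (n + k)))))"
  proof (rule sum.cong[OF refl])
    fix n
    have "of_real (w n) * expi ((r - \<alpha>) * real n) * (of_nat (divisor_tau (n + k)) * expi (\<alpha> * real (n + k)))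
        = expi ((\<alpha> - r) * real k) * (of_real (w n) * (of_nat (divisor_tau (n + k)) * expi (r * real (n + k))))" for k
    proof -
      have "of_real (w n) * expi ((r - \<alpha>) * real n) * (of_nat (divisor_tau (n + k)) * expi (\<alpha> * real (n + k)))
        = of_real (w n) * of_nat (divisor_tau (n + k)) * (expi ((r - \<alpha>) * real n) * expi (\<alpha> * real (n + k)))"
        by (simp only: mult_ac)
      then show ?thesis unfolding e by (simp only: mult_ac)
    qed
    then show "of_real (w n) * expi ((r - \<alpha>) * real n) * window_sum \<alpha> K n = (\<Sum>k\<in>{1..K}.
      expi ((\<alpha> - r) * real k) * (of_real (w n) * (of_nat (divisor_tau (n + k)) * expi (r * real (n + k)))))"
      unfolding window_sum_def sum_distrib_left by (rule sum.cong[OF refl])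
  qed
  also have "\<dots> = (\<Sum>k\<in>{1..K}. \<Sum>n\<in>{1..3 * N ^ 2}.
      expi ((\<alpha> - r) * real k) * (of_real (w n) * (of_nat (divisor_tau (n + k)) * expi (r * real (n + k)))))"
    by (rule sum.swap)
  also have "\<dots> = (\<Sum>k\<in>{1..K}. expi ((\<alpha> - r) * real k) * smooth_sum N k r)"
  proof (rule sum.cong[OF refl])
    fix k assume "k \<in> {1..K}"
    then have "k \<le> N ^ 2" using assms by simp
    show "(\<Sum>n\<in>{1..3 * N ^ 2}.
      expi ((\<alpha> - r) * real k) * (of_real (w n) * (of_nat (divisor_tau (n + k)) * expi (r * real (n + k)))))
      = expi ((\<alpha> - r) * real k) * smooth_sum N k r"
      unfolding smooth_sum_shift[OF assms(1) \<open>k \<le> N ^ 2\<close>] w_def by (simp add: sum_distrib_left)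
  qed
  finally show ?thesis .
qed

lemma norm_window_transform_ge:
  fixes A :: int
  assumes "coprime A (int q)" "q > 0" "30 * q \<le> N" "K \<le> N ^ 2"
    "\<bar>\<alpha> - of_int A / real q\<bar> * real K \<le> 1 / 4"
  shows "norm (window_transform \<alpha> K N (of_int A / real q))
           \<ge> real K * (real N ^ 2 / (8 * real q) * ln (real N / (2 * real q)))"
proof -
  define r where "r = of_int A / real q"
  define P0 where "P0 = real N ^ 2 / (2 * real q) * ln (real N / (2 * real q))"
  have N: "N > 0" using assms by simp
  have qN: "30 * real q \<le> real N" using assms(3) by linarith
  have "ln (exp 1) \<le> ln (real N / (2 * real q))"
  proof (rule ln_mono)
    have "exp 1 \<le> (3::real)" by (rule exp_le)
    also have "3 \<le> real N / (2 * real q)" using qN assms(2) by (simp add: pos_le_divide_eq)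
    finally show "exp 1 \<le> real N / (2 * real q)" .
  qed simp
  then have ln1: "1 \<le> ln (real N / (2 * real q))" by simp
  \<comment> \<open>Keeps the error 40 q below P0 / 8, so it cannot spoil the real part P0 / 2 of
    the main term.\<close>
  have P0_ge: "P0 \<ge> 320 * real q"
  proof -
    have "(30 * real q) ^ 2 \<le> real N ^ 2" using qN by (intro power_mono) auto
    then have "900 * real q ^ 2 / (2 * real q) \<le> real N ^ 2 / (2 * real q)"
      by (intro divide_right_mono) (auto simp: power_mult_distrib)
    then have "450 * real q \<le> real N ^ 2 / (2 * real q)"
      using assms(2) by (simp add: power2_eq_square)
    also have "\<dots> \<le> P0"
      unfolding P0_def using mult_left_mono[OF ln1, of "real N ^ 2 / (2 * real q)"] by simp
    finally show ?thesis by linarith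
  qed
  \<comment> \<open>The phases are centred at the midpoint of the window, so that they all lie within 1/8 of 0.\<close>
  define th where "th k = (\<alpha> - r) * (real k - (real K + 1) / 2)" for k
  have Re_ge: "Re (expi (th k) * smooth_sum N k r) \<ge> P0 / 4" if k: "k \<in> {1..K}" for k
  proof -
    have "\<bar>real k - (real K + 1) / 2\<bar> \<le> real K / 2" using k by (simp add: abs_le_iff field_simps)
    then have "\<bar>th k\<bar> \<le> \<bar>\<alpha> - r\<bar> * (real K / 2)"
      unfolding th_def abs_mult by (intro mult_left_mono) auto
    also have "\<dots> = \<bar>\<alpha> - r\<bar> * real K / 2" by simp
    also have "\<dots> \<le> 1 / 8" using divide_right_mono[OF assms(5), of 2] by (simp add: r_def)
    finally have half: "Re (expi (th k)) \<ge> 1 / 2" by (rule Re_expi_ge_half)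
    have "k \<le> N ^ 2" using k assms by simp
    then obtain P E where PE: "smooth_sum N k r = of_real P + E" "P \<ge> P0" "norm E \<le> 40 * real q"
      unfolding r_def P0_def using smooth_sum_approx[OF assms(1,2,3)] by metis
    have "Re (expi (th k) * smooth_sum N k r) = Re (expi (th k)) * P + Re (expi (th k) * E)"
      by (simp add: PE(1) distrib_left)
    moreover have "Re (expi (th k)) * P \<ge> 1 / 2 * P0"
      using half PE(2) P0_ge by (intro mult_mono) auto
    moreover have "\<bar>Re (expi (th k) * E)\<bar> \<le> 40 * real q"
      using abs_Re_le_cmod[of "expi (th k) * E"] PE(3) by (simp add: norm_mult)
    ultimately show ?thesis using P0_ge by linarith
  qed
  have "real K * (P0 / 4) = (\<Sum>k\<in>{1..K}. P0 / 4)" by simp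
  also have "\<dots> \<le> (\<Sum>k\<in>{1..K}. Re (expi (th k) * smooth_sum N k r))"
    by (intro sum_mono Re_ge)
  also have "\<dots> = Re (\<Sum>k\<in>{1..K}. expi (th k) * smooth_sum N k r)" by simp
  also have "(\<Sum>k\<in>{1..K}. expi (th k) * smooth_sum N k r)
      = expi (- ((\<alpha> - r) * ((real K + 1) / 2))) * window_transform \<alpha> K N r"
  proof -
    have "expi (th k) = expi (- ((\<alpha> - r) * ((real K + 1) / 2))) * expi ((\<alpha> - r) * real k)" for k
      unfolding expi_add[symmetric] th_def by (simp add: algebra_simps)
    then show ?thesis
      unfolding window_transform_eq[OF N assms(4)] by (simp add: sum_distrib_left mult_ac)
  qed
  also have "Re \<dots> \<le> norm \<dots>" by (rule complex_Re_le_cmod)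
  also have "\<dots> = norm (window_transform \<alpha> K N r)" by (simp add: norm_mult)
  finally show ?thesis by (simp add: P0_def r_def)
qed

text \<open>Write 1 / n as the sum of totient d / n^2 over the divisors d of n. With n = d g the
  harmonic sum is at most the sum in question times the sum of 1 / g^2, which is at most 2.\<close>

lemma sum_totient_over_square_ge:
  "(\<Sum>k\<in>{1..H}. real (totient k) / real k ^ 2) \<ge> ln (real H + 1) / 2"
proof -
  define \<phi> where "\<phi> k = real (totient k) / real k ^ 2" for k
  have \<phi>0: "\<phi> k \<ge> 0" for k by (simp add: \<phi>_def)
  have factors_le: "b \<le> H \<and> k \<le> H" if "0 < b" "0 < k" "b * k \<le> H" for b k
  proof -
    have "b * 1 \<le> b * k" "1 * k \<le> b * k" using that by (intro mult_le_mono; simp)+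
    then show ?thesis using that by linarith
  qed
  have "ln (real H + 1) \<le> harm H" by (rule ln_le_harm)
  also have "\<dots> = (\<Sum>n\<in>{1..H}. \<Sum>d | d dvd n. real (totient d) / real n ^ 2)"
    unfolding harm_def
  proof (rule sum.cong[OF refl])
    fix n assume n: "n \<in> {1..H}"
    have "(\<Sum>d | d dvd n. real (totient d) / real n ^ 2) = real (\<Sum>d | d dvd n. totient d) / real n ^ 2"
      by (simp add: sum_divide_distrib)
    then show "inverse (of_nat n) = (\<Sum>d | d dvd n. real (totient d) / real n ^ 2)"
      using n unfolding totient_divisor_sum by (simp add: power2_eq_square field_simps)
  qed
  also have "\<dots> = (\<Sum>(n, d)\<in>(SIGMA n:{1..H}. {d. d dvd n}). real (totient d) / real n ^ 2)"
    by (rule sum.Sigma) (auto intro: finite_divisors_nat)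
  also have "\<dots> = (\<Sum>(d, g) | (d, g) \<in> {1..H} \<times> {1..H} \<and> d * g \<le> H. \<phi> d * (1 / real g ^ 2))"
    by (rule sum.reindex_bij_witness[where i = "\<lambda>(d, g). (d * g, d)" and j = "\<lambda>(n, d). (d, n div d)"])
       (auto elim!: dvdE simp: Suc_le_eq \<phi>_def power_mult_distrib dest: factors_le)
  also have "\<dots> \<le> (\<Sum>(d, g)\<in>{1..H} \<times> {1..H}. \<phi> d * (1 / real g ^ 2))"
    by (rule sum_mono2) (use \<phi>0 in auto)
  also have "\<dots> = (\<Sum>d\<in>{1..H}. \<phi> d) * (\<Sum>g\<in>{1..H}. 1 / real g ^ 2)"
    by (simp add: sum_product sum.cartesian_product)
  also have "\<dots> \<le> (\<Sum>d\<in>{1..H}. \<phi> d) * 2"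
    using \<phi>0 by (intro mult_left_mono sum_inverse_squares_le sum_nonneg)
  finally show ?thesis by (simp add: \<phi>_def)
qed

section \<open>Farey fractions near u/s\<close>

text \<open>An inverse t of u mod s gives determinant 1, and s - t gives determinant -1. One of the
  two is at least s / 2.\<close>

lemma farey_neighbour:
  fixes u :: int and s :: nat
  assumes "coprime u (int s)" "s \<ge> 2"
  obtains u' :: int and s' :: nat
  where "s \<le> 2 * s'" "s' \<le> s" "\<bar>u * int s' - u' * int s\<bar> = 1"
proof -
  obtain x where x: "[u * x = 1] (mod int s)"
    using cong_solve_coprime_int[OF assms(1)] by blast
  define t where "t = x mod int s"
  have t: "0 \<le> t" "t < int s" using assms by (auto simp: t_def)
  have "[u * t = 1] (mod int s)" using x unfolding t_def cong_def by (simp add: mod_mult_right_eq)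
  then obtain v where v: "u * t - 1 = int s * v" by (auto simp: cong_iff_dvd_diff)
  show ?thesis
  proof (cases "int s \<le> 2 * t")
    case True
    show ?thesis
      by (rule that[of "nat t" v]) (use t True v in \<open>auto simp: algebra_simps nat_le_iff\<close>)
  next
    case False
    have "u * int (nat (int s - t)) - (u - v) * int s = - 1" using t v by (simp add: algebra_simps)
    then show ?thesis
      by (intro that[of "nat (int s - t)" "u - v"]) (use t False in auto)
  qed
qed

text \<open>Everything follows from determinants. By \<open>id1\<close> and \<open>id2\<close>, num
  and den determine a and k - a up to the sign \<sigma>, so a common divisor divides both a and k.
  The determinant of two such fractions is, up to sign, a l - b k, which is nonzero for distinct
  coprime pairs. The sign \<sigma> tells on which side of u/s the neighbour lies.\<close>

lemma farey_fractions:
  fixes u u' \<sigma> :: int and s s' :: nat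
  assumes s: "s \<ge> 2" "s \<le> 2 * s'" "s' \<le> s" and det: "u * int s' - u' * int s = \<sigma>" "\<bar>\<sigma>\<bar> = 1"
  defines "num \<equiv> \<lambda>(a, k). int a * u' + int (k - a) * u"
    and "den \<equiv> \<lambda>(a, k). a * s' + (k - a) * s"
  assumes ak: "0 < a" "a \<le> k" "coprime a k"
  shows "coprime (num (a, k)) (int (den (a, k)))"
    and "0 < den (a, k)" and "den (a, k) \<le> k * s"
    and "- of_int \<sigma> * (of_int (num (a, k)) / real (den (a, k)) - of_int u / real s) \<in> {0..2 / real s ^ 2}"
    and "\<lbrakk>0 < b; b \<le> l; coprime b l; (a, k) \<noteq> (b, l)\<rbrakk> \<Longrightarrow>
      \<bar>of_int (num (a, k)) / real (den (a, k)) - of_int (num (b, l)) / real (den (b, l))\<bar>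
        \<ge> 1 / (real (den (a, k)) * real (den (b, l)))"
proof -
  have s'0: "s' > 0" using s by simp
  have den_pos: "0 < den (b, l)" if "0 < b" for b l using that s'0 by (simp add: den_def)
  have den_int: "int (den (b, l)) = int b * int s' + int (l - b) * int s" for b l
    by (simp add: den_def)
  have num: "num (b, l) = int b * u' + int (l - b) * u" for b l by (simp add: num_def)
  have id1: "int s' * num (a, k) - u' * int (den (a, k)) = int (k - a) * \<sigma>"
    unfolding num den_int det(1)[symmetric] by (simp add: algebra_simps)
  have id2: "u * int (den (a, k)) - int s * num (a, k) = int a * \<sigma>"
    unfolding num den_int det(1)[symmetric] by (simp add: algebra_simps)
  show "coprime (num (a, k)) (int (den (a, k)))"
  proof (rule coprimeI)
    fix d assume d: "d dvd num (a, k)" "d dvd int (den (a, k))"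
    have "d dvd int (k - a) * \<sigma>" "d dvd int a * \<sigma>"
      unfolding id1[symmetric] id2[symmetric] using d by auto
    moreover have "\<sigma> = 1 \<or> \<sigma> = - 1" using det(2) by auto
    ultimately have "d dvd int (k - a)" "d dvd int a" by auto
    then have "d dvd int (k - a) + int a" by simp
    then have "d dvd int k" using ak by (simp add: of_nat_diff)
    moreover have "coprime (int a) (int k)" using ak by simp
    ultimately show "is_unit d" using \<open>d dvd int a\<close> by (metis coprime_common_divisor)
  qed
  show q0: "0 < den (a, k)" using den_pos[OF ak(1)] .
  have "a * s' + (k - a) * s \<le> a * s + (k - a) * s" using s by simp
  also have "\<dots> = k * s" using ak by (simp flip: add_mult_distrib)
  finally show "den (a, k) \<le> k * s" by (simp add: den_def)
  have "of_int (num (a, k)) / real (den (a, k)) - of_int u / real s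
      = - of_int (u * int (den (a, k)) - int s * num (a, k)) / (real s * real (den (a, k)))"
    using q0 s by (simp add: field_simps)
  also have "\<dots> = - (real a * of_int \<sigma>) / (real s * real (den (a, k)))"
    unfolding id2 by simp
  finally have "- of_int \<sigma> * (of_int (num (a, k)) / real (den (a, k)) - of_int u / real s)
      = of_int (\<sigma> * \<sigma>) * real a / (real s * real (den (a, k)))" by simp
  also have "\<sigma> * \<sigma> = 1" using det(2) by (metis abs_mult_self_eq mult_1)
  finally have eq: "- of_int \<sigma> * (of_int (num (a, k)) / real (den (a, k)) - of_int u / real s)
      = real a / (real s * real (den (a, k)))" by simp
  \<comment> \<open>Here s <= 2 s' enters: it bounds a / (s den) by 2 / s^2.\<close>
  have "a * s \<le> 2 * den (a, k)"
  proof -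
    have "a * s \<le> a * (2 * s')" using s(2) by (rule mult_le_mono2)
    also have "\<dots> = 2 * (a * s')" by simp
    also have "\<dots> \<le> 2 * den (a, k)" by (simp add: den_def)
    finally show ?thesis .
  qed
  then have "real (a * s) \<le> real (2 * den (a, k))" by (simp only: of_nat_le_iff)
  then have "real a / (real s * real (den (a, k))) \<le> 2 / real s ^ 2"
    using q0 s by (simp add: field_simps power2_eq_square)
  then show "- of_int \<sigma> * (of_int (num (a, k)) / real (den (a, k)) - of_int u / real s) \<in> {0..2 / real s ^ 2}"
    unfolding eq by simp
  assume b: "0 < b" "b \<le> l" "coprime b l" "(a, k) \<noteq> (b, l)"
  have q1: "0 < den (b, l)" using den_pos[OF b(1)] .
  have ne: "int a * int l - int b * int k \<noteq> 0"
  proof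
    assume "int a * int l - int b * int k = 0"
    then have "int (a * l) = int (b * k)" by simp
    then have eq: "a * l = b * k" by (simp only: of_nat_eq_iff)
    have "k dvd a * l" "l dvd b * k" using eq by (metis dvd_triv_right)+
    then have "k dvd l" "l dvd k" using ak(3) b(3) by (metis coprime_dvd_mult_right_iff coprime_commute)+
    then have "k = l" by (rule dvd_antisym)
    then show False using eq b ak by simp
  qed
  have "num (a, k) * int (den (b, l)) - num (b, l) * int (den (a, k)) = - (int a * int l - int b * int k) * \<sigma>"
    unfolding num den_int det(1)[symmetric] using ak b by (simp add: of_nat_diff algebra_simps)
  then have "\<bar>num (a, k) * int (den (b, l)) - num (b, l) * int (den (a, k))\<bar> = \<bar>int a * int l - int b * int k\<bar>"
    using det(2) by (simp add: abs_mult)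
  then have "1 \<le> \<bar>num (a, k) * int (den (b, l)) - num (b, l) * int (den (a, k))\<bar>" using ne by linarith
  then have "real_of_int 1 \<le> of_int \<bar>num (a, k) * int (den (b, l)) - num (b, l) * int (den (a, k))\<bar>"
    by (simp only: of_int_le_iff)
  then have le: "1 \<le> \<bar>of_int (num (a, k)) * real (den (b, l)) - of_int (num (b, l)) * real (den (a, k))\<bar>" by simp
  have "of_int (num (a, k)) / real (den (a, k)) - of_int (num (b, l)) / real (den (b, l))
     = (of_int (num (a, k)) * real (den (b, l)) - of_int (num (b, l)) * real (den (a, k))) / (real (den (a, k)) * real (den (b, l)))"
    using q0 q1 by (simp add: field_simps)
  then have "\<bar>of_int (num (a, k)) / real (den (a, k)) - of_int (num (b, l)) / real (den (b, l))\<bar>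
     = \<bar>of_int (num (a, k)) * real (den (b, l)) - of_int (num (b, l)) * real (den (a, k))\<bar> / (real (den (a, k)) * real (den (b, l)))"
    by (simp only: abs_divide abs_mult abs_of_nat)
  then show "\<bar>of_int (num (a, k)) / real (den (a, k)) - of_int (num (b, l)) / real (den (b, l))\<bar>
        \<ge> 1 / (real (den (a, k)) * real (den (b, l)))"
    using le by (simp only:) (intro divide_right_mono, auto)
qed

section \<open>The mean square of window sums\<close>

text \<open>H truncates the family of mediants: H^2 s <= N keeps N / (2 q) >= H / 2 for every
  denominator q <= H s. The constant 384 is 8^2 from the squared main term, times 2 from the totient
  sum, times 3 from the large sieve.\<close>

lemma sum_window_sum_ge:
  fixes u :: int and s :: nat
  assumes "coprime u (int s)" "s \<ge> 2" and approx: "\<bar>\<alpha> - of_int u / real s\<bar> \<le> 1 / real s ^ 2"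
    and K: "12 * K \<le> s ^ 2" and H: "H \<ge> 30" "H ^ 2 * s \<le> N"
  shows "(\<Sum>n\<in>{1..3 * N ^ 2}. (norm (window_sum \<alpha> K n)) ^ 2)
           \<ge> real K ^ 2 * real N ^ 2 / (384 * real s ^ 2) * ln (real H / 2) ^ 3"
proof -
  obtain u' s' where farey: "s \<le> 2 * s'" "s' \<le> s" "\<bar>u * int s' - u' * int s\<bar> = 1"
    using farey_neighbour[OF assms(1,2)] by blast
  define \<sigma> where "\<sigma> = u * int s' - u' * int s"
  define num where "num = (\<lambda>(a, k). int a * u' + int (k - a) * u)"
  define den where "den = (\<lambda>(a, k). a * s' + (k - a) * s)"
  \<comment> \<open>Indexed with k first, so that sums over I group by k; \<open>num\<close> and
    \<open>den\<close> take (a, k).\<close>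
  define I where "I = (SIGMA k:{1..H}. totatives k)"
  define r where "r = (\<lambda>(k, a). of_int (num (a, k)) / real (den (a, k)))"
  note ff = farey_fractions[OF assms(2) farey(1,2) \<sigma>_def[symmetric] farey(3)[folded \<sigma>_def], folded num_def den_def]
  have I: "0 < a" "a \<le> k" "coprime a k" "1 \<le> k" "k \<le> H" if "(k, a) \<in> I" for k a
    using that by (auto simp: I_def in_totatives_iff)
  have finI: "finite I" by (auto simp: I_def)
  have Hs: "30 * (H * s) \<le> N" "H * s \<le> N"
  proof -
    have "30 * (H * s) \<le> H * (H * s)" using H(1) by (intro mult_le_mono1)
    also have "\<dots> \<le> N" using H(2) by (simp add: power2_eq_square mult.assoc)
    finally show "30 * (H * s) \<le> N" .
    then show "H * s \<le> N" by simp
  qed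
  have sN: "s \<le> N" using Hs(2) H(1) by (cases H) auto
  have N0: "N > 0" using sN assms(2) by simp
  have L0: "real N ^ 2 > 0" using N0 by simp
  have KN: "K \<le> N ^ 2"
  proof -
    have "K \<le> s ^ 2" using K by simp
    also have "\<dots> \<le> N ^ 2" using sN by (rule power_mono) simp
    finally show ?thesis .
  qed
  have den_le: "den (a, k) \<le> k * s" "k * s \<le> H * s" if "(k, a) \<in> I" for k a
    using ff(3)[of a k] I[OF that] by auto
  have \<sigma>: "\<sigma> = 1 \<or> \<sigma> = - 1" using farey(3) by (auto simp: \<sigma>_def)
  have spaced: "\<bar>r i - r j\<bar> \<ge> 1 / real N ^ 2" if "i \<in> I" "j \<in> I" "i \<noteq> j" for i j
  proof -
    obtain k a l b where ij: "i = (k, a)" "j = (l, b)" by (cases i, cases j) auto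
    have ijI: "(k, a) \<in> I" "(l, b) \<in> I" using that ij by auto
    have d: "den (a, k) \<le> N" "den (b, l) \<le> N" "0 < den (a, k)" "0 < den (b, l)"
      using order_trans[OF order_trans[OF den_le[OF ijI(1)]] Hs(2)] order_trans[OF order_trans[OF den_le[OF ijI(2)]] Hs(2)]
        ff(2)[OF I(1-3)[OF ijI(1)]] ff(2)[OF I(1-3)[OF ijI(2)]] by auto
    then have "real (den (a, k)) * real (den (b, l)) \<le> real N * real N" by (intro mult_mono) auto
    then have "1 / real N ^ 2 \<le> 1 / (real (den (a, k)) * real (den (b, l)))"
      unfolding power2_eq_square using d N0 by (intro divide_left_mono) auto
    also have "\<dots> \<le> \<bar>r i - r j\<bar>"
      unfolding ij r_def prod.case using that ij I[of k a] I[of l b] by (intro ff(5)) auto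
    finally show ?thesis .
  qed
  have range: "- of_int \<sigma> * (r i - of_int u / real s) \<in> {0..2 / real s ^ 2}" if "i \<in> I" for i
    using ff(4)[of "snd i" "fst i"] I[of "fst i" "snd i"] that by (simp add: r_def case_prod_beta)
  have s2: "(2::real) ^ 2 \<le> real s ^ 2" using assms(2) by (intro power_mono) auto
  have close: "\<bar>r i - r j\<bar> \<le> 1 / 2" if "i \<in> I" "j \<in> I" for i j
  proof -
    have "\<bar>r i - r j\<bar> \<le> 2 / real s ^ 2" using range[OF that(1)] range[OF that(2)] \<sigma> by auto
    also have "\<dots> \<le> 2 / 2 ^ 2" using s2 assms(2) by (intro divide_left_mono) auto
    also have "\<dots> = 1 / 2" by simp
    finally show ?thesis .
  qed
  define F where "F n = window_sum \<alpha> K (nat n)" for n :: int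
  \<comment> \<open>The sieve is applied to the translates r i - \<alpha>, which have the same
    differences.\<close>
  have LS: "(\<Sum>i\<in>I. (norm (window_transform \<alpha> K N (r i))) ^ 2)
      \<le> 3 * real N ^ 2 * (\<Sum>n\<in>{1..3 * int N ^ 2}. tent (real N ^ 2) (of_int n) * (norm (F n)) ^ 2)"
    unfolding window_transform_def F_def
    by (rule tent_large_sieve[OF N0 finI, of "\<lambda>i. r i - \<alpha>"]) (use spaced close in auto)
  have up: "(\<Sum>n\<in>{1..3 * int N ^ 2}. tent (real N ^ 2) (of_int n) * (norm (F n)) ^ 2)
      \<le> (\<Sum>n\<in>{1..3 * N ^ 2}. (norm (window_sum \<alpha> K n)) ^ 2)"
  proof -
    have "(\<Sum>n\<in>{1..3 * int N ^ 2}. tent (real N ^ 2) (of_int n) * (norm (F n)) ^ 2)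
      \<le> (\<Sum>n\<in>{1..3 * int N ^ 2}. 1 * (norm (F n)) ^ 2)"
      using L0 by (intro sum_mono mult_right_mono tent_le_1) auto
    also have "\<dots> = (\<Sum>n\<in>int ` {1..3 * N ^ 2}. 1 * (norm (F n)) ^ 2)"
      by (simp add: image_int_atLeastAtMost)
    also have "\<dots> = (\<Sum>n\<in>{1..3 * N ^ 2}. (norm (window_sum \<alpha> K n)) ^ 2)"
      by (simp add: sum.reindex F_def)
    finally show ?thesis .
  qed
  define D where "D = real K * real N ^ 2 / (8 * real s) * ln (real H / 2)"
  have lnH: "ln (real H / 2) \<ge> 0" using H(1) by (intro ln_ge_zero) auto
  have lower: "(norm (window_transform \<alpha> K N (r i))) ^ 2 \<ge> (D / real (fst i)) ^ 2" if i: "i \<in> I" for i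
  proof -
    obtain k a where ka: "i = (k, a)" by (cases i)
    note A = I[of k a, OF i[unfolded ka]]
    define q where "q = den (a, k)"
    have q: "0 < q" "q \<le> k * s" "q \<le> H * s"
      using ff(2)[OF A(1-3)] den_le[OF i[unfolded ka]]
        order_trans[OF den_le[OF i[unfolded ka]]] by (auto simp: q_def)
    have qr: "real q \<le> real k * real s" "real q \<le> real H * real s"
      using q(2,3) by (metis of_nat_le_iff of_nat_mult)+
    have ri: "r i = of_int (num (a, k)) / real q" by (simp add: r_def ka q_def)
    have "\<bar>\<alpha> - r i\<bar> \<le> 3 / real s ^ 2"
    proof -
      have "\<bar>r i - of_int u / real s\<bar> \<le> 2 / real s ^ 2" using range[OF i] \<sigma> by auto
      moreover have "1 / real s ^ 2 + 2 / real s ^ 2 = 3 / real s ^ 2" by (simp flip: add_divide_distrib)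
      ultimately show ?thesis using approx by linarith
    qed
    \<comment> \<open>The distance 3 / s^2 against K <= s^2 / 12 gives exactly the 1/4 that keeps
      the phases aligned.\<close>
    then have "\<bar>\<alpha> - r i\<bar> * real K \<le> 3 / real s ^ 2 * (real s ^ 2 / 12)"
    proof (rule mult_mono)
      have "real (12 * K) \<le> real (s ^ 2)" using K by (simp only: of_nat_le_iff)
      then show "real K \<le> real s ^ 2 / 12" by simp
    qed auto
    also have "\<dots> = 1 / 4" using assms(2) by simp
    finally have ang: "\<bar>\<alpha> - of_int (num (a, k)) / real q\<bar> * real K \<le> 1 / 4" unfolding ri .
    have HN: "real H / 2 \<le> real N / (2 * real q)"
    proof -
      have "real H * real q \<le> real H * (real H * real s)" using qr by (intro mult_left_mono) auto
      also have "\<dots> = real (H ^ 2 * s)" by (simp add: power2_eq_square)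
      also have "\<dots> \<le> real N" using H(2) by (simp only: of_nat_le_iff)
      finally show ?thesis using q(1) by (simp add: field_simps)
    qed
    have "D / real k = real K * (real N ^ 2 / (8 * (real k * real s)) * ln (real H / 2))"
      by (simp add: D_def mult_ac)
    also have "\<dots> \<le> real K * (real N ^ 2 / (8 * real q) * ln (real N / (2 * real q)))"
    proof (intro mult_left_mono mult_mono)
      show "real N ^ 2 / (8 * (real k * real s)) \<le> real N ^ 2 / (8 * real q)"
        using q(1) qr(1) A(4) assms(2) by (intro divide_left_mono) auto
      show "ln (real H / 2) \<le> ln (real N / (2 * real q))" using HN H(1) by (intro ln_mono) auto
    qed (use lnH in auto)
    also have "\<dots> \<le> norm (window_transform \<alpha> K N (r i))"
      unfolding ri
    proof (rule norm_window_transform_ge)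
      show "coprime (num (a, k)) (int q)" unfolding q_def using A by (intro ff(1))
      show "30 * q \<le> N" using q(3) Hs(1) by linarith
    qed (use q KN ang in auto)
    finally show ?thesis using lnH by (intro power_mono) (auto simp: ka D_def)
  qed
  have "(\<Sum>i\<in>I. (D / real (fst i)) ^ 2) = (\<Sum>k\<in>{1..H}. \<Sum>a\<in>totatives k. (D / real k) ^ 2)"
    unfolding I_def by (subst sum.Sigma) (auto simp: case_prod_beta)
  also have "\<dots> = D ^ 2 * (\<Sum>k\<in>{1..H}. real (totient k) / real k ^ 2)"
    by (simp add: totient_def power_divide sum_distrib_left mult_ac)
  finally have sumD: "(\<Sum>i\<in>I. (D / real (fst i)) ^ 2) = \<dots>" .
  have lnH1: "ln (real H / 2) \<le> ln (real H + 1)" using H(1) by (intro ln_mono) auto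
  have "D ^ 2 * (ln (real H / 2) / 2) \<le> D ^ 2 * (\<Sum>k\<in>{1..H}. real (totient k) / real k ^ 2)"
    using sum_totient_over_square_ge[of H] lnH1 by (intro mult_left_mono) auto
  also have "\<dots> \<le> (\<Sum>i\<in>I. (norm (window_transform \<alpha> K N (r i))) ^ 2)"
    unfolding sumD[symmetric] by (intro sum_mono lower)
  also have "\<dots> \<le> 3 * real N ^ 2 * (\<Sum>n\<in>{1..3 * N ^ 2}. (norm (window_sum \<alpha> K n)) ^ 2)"
    by (rule order_trans[OF LS]) (intro mult_left_mono up, simp)
  finally have "D ^ 2 * (ln (real H / 2) / 2) / (3 * real N ^ 2)
      \<le> (\<Sum>n\<in>{1..3 * N ^ 2}. (norm (window_sum \<alpha> K n)) ^ 2)"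
    using N0 by (simp add: pos_divide_le_eq mult_ac)
  moreover have "D ^ 2 * (ln (real H / 2) / 2) / (3 * real N ^ 2)
      = real K ^ 2 * real N ^ 2 / (384 * real s ^ 2) * ln (real H / 2) ^ 3"
    using N0 assms(2) by (simp add: D_def power_mult_distrib power_divide field_simps power2_eq_square power3_eq_cube)
  ultimately show ?thesis by simp
qed

section \<open>\<open>short_sum\<close> and \<open>long_sum\<close> in terms of
  \<open>window_sum\<close>\<close>

lemma short_sum_eq_window_sum:
  assumes "y \<ge> 0" "real n + real (nat \<lfloor>y\<rfloor>) \<le> x"
  shows "short_sum \<alpha> x y (int n) = window_sum \<alpha> (nat \<lfloor>y\<rfloor>) n"
proof -
  define K where "K = nat \<lfloor>y\<rfloor>"
  have iff: "real m \<le> real n + y \<longleftrightarrow> m \<le> n + K" for m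
  proof -
    have "real m \<le> real n + y \<longleftrightarrow> int m - int n \<le> \<lfloor>y\<rfloor>" by (simp add: le_floor_iff) linarith
    also have "\<dots> \<longleftrightarrow> m \<le> n + K"
    proof -
      have "\<lfloor>y\<rfloor> \<ge> 0" using assms(1) by simp
      then show ?thesis unfolding K_def by linarith
    qed
    finally show ?thesis .
  qed
  have "{m::nat. int n < int m \<and> real m \<le> real_of_int (int n) + y \<and> 1 \<le> m \<and> real m \<le> x} = {1 + n..K + n}"
    using assms(2) by (auto simp: iff K_def[symmetric])
  then show ?thesis
    unfolding short_sum_def window_sum_def K_def[symmetric]
    using sum.shift_bounds_cl_nat_ivl[of "\<lambda>m. of_nat (divisor_tau m) * expi (\<alpha> * real m)" 1 n K]
    by (simp add: add.commute)
qed

lemma long_sum_nat: "long_sum \<alpha> (real n) = (\<Sum>m\<in>{1..n}. of_nat (divisor_tau m) * expi (\<alpha> * real m))"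
  unfolding long_sum_def by (rule sum.cong) auto

lemma long_sum_diff_eq_window_sum: "long_sum \<alpha> (real (n + K)) - long_sum \<alpha> (real n) = window_sum \<alpha> K n"
proof -
  have "{1..n + K} = {1..n} \<union> {1 + n..K + n}" "{1..n} \<inter> {1 + n..K + n} = {}" by auto
  then have "long_sum \<alpha> (real (n + K)) = long_sum \<alpha> (real n)
      + (\<Sum>m\<in>{1 + n..K + n}. of_nat (divisor_tau m) * expi (\<alpha> * real m))"
    unfolding long_sum_nat by (simp add: sum.union_disjoint)
  then show ?thesis
    unfolding window_sum_def
    using sum.shift_bounds_cl_nat_ivl[of "\<lambda>m. of_nat (divisor_tau m) * expi (\<alpha> * real m)" 1 n K]
    by (simp add: add.commute)
qed

lemma finite_real_of_int_interval: "finite {n::int. - (y::real) < of_int n \<and> of_int n \<le> (x::real)}"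
  by (rule finite_subset[of _ "{\<lfloor>- y\<rfloor>..\<lfloor>x\<rfloor>}"]) (auto simp: le_floor_iff floor_le_iff)

lemma sum_short_sum_ge_1:
  assumes "y \<ge> 1" "x \<ge> 1"
  shows "(\<Sum>n\<in>{n::int. - y < of_int n \<and> of_int n \<le> x}. (cmod (short_sum \<alpha> x y n)) ^ 2) \<ge> 1"
proof -
  \<comment> \<open>The window starting at n contains the single integer 1.\<close>
  define n where "n = 1 - \<lfloor>y\<rfloor>"
  have "{m::nat. n < int m \<and> real m \<le> of_int n + y \<and> 1 \<le> m \<and> real m \<le> x} = {1}"
  proof (rule equalityI; rule subsetI)
    fix m assume "m \<in> {m::nat. n < int m \<and> real m \<le> of_int n + y \<and> 1 \<le> m \<and> real m \<le> x}"
    then have "real m \<le> 1 - of_int \<lfloor>y\<rfloor> + y" "1 \<le> m" by (auto simp: n_def)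
    then have "real m < 2" by linarith
    then show "m \<in> {1}" using \<open>1 \<le> m\<close> by simp
  next
    fix m :: nat assume "m \<in> {1}"
    moreover have "\<lfloor>y\<rfloor> \<ge> 1" using assms(1) by (simp add: le_floor_iff)
    ultimately show "m \<in> {m::nat. n < int m \<and> real m \<le> of_int n + y \<and> 1 \<le> m \<and> real m \<le> x}"
      using assms(2) by (simp add: n_def)
  qed
  then have "cmod (short_sum \<alpha> x y n) = 1"
    unfolding short_sum_def by (simp add: divisor_tau_def norm_mult)
  moreover have "n \<in> {n::int. - y < of_int n \<and> of_int n \<le> x}"
  proof -
    have "real_of_int n \<le> 1" using assms(1) by (simp add: n_def le_floor_iff)
    moreover have "- y < real_of_int n" unfolding n_def by simp linarith
    ultimately show ?thesis using assms(2) by simp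
  qed
  ultimately show ?thesis
    using member_le_sum[of n "{n::int. - y < of_int n \<and> of_int n \<le> x}" "\<lambda>n. (cmod (short_sum \<alpha> x y n)) ^ 2"]
      finite_real_of_int_interval[of y x] by simp
qed

text \<open>Choice of parameters. N near sqrt x / 2 keeps every window with n <= 3 N^2 inside
  [1, x], and H is the largest integer with H^2 s <= N. The threshold 2^24 / \<epsilon>^2 is what
  makes (H / 2)^8 at least x / y.\<close>

lemma sum_short_sum_ge:
  fixes u s :: int
  assumes "\<epsilon> > 0" "s \<ge> 1" "coprime u s" "\<bar>\<alpha> - of_int u / of_int s\<bar> \<le> 1 / (of_int s) ^ 2"
    and y: "y \<ge> 1" "\<epsilon> * (of_int s) ^ 2 \<le> y" "y \<le> (of_int s) ^ 2 / 12"
    and x: "x \<ge> 16" "x / y \<ge> 2 ^ 24 / \<epsilon> ^ 2"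
  shows "(\<Sum>n\<in>{n::int. - y < of_int n \<and> of_int n \<le> x}. (cmod (short_sum \<alpha> x y n)) ^ 2)
           \<ge> \<epsilon> / 2 ^ 24 * x * y * ln (x / y) ^ 3"
proof -
  define t where "t = nat s"
  define z where "z = x / y"
  define K where "K = nat \<lfloor>y\<rfloor>"
  define N where "N = nat \<lfloor>sqrt x / 2\<rfloor>"
  define H where "H = nat \<lfloor>sqrt (real N / real t)\<rfloor>"
  have t: "int t = s" "real t = of_int s" using assms(2) by (simp_all add: t_def)
  have t_sq: "\<epsilon> * real t ^ 2 \<le> y" "12 * y \<le> real t ^ 2" using y by (simp_all add: t)
  \<comment> \<open>For s = 1 the upper bound on y would read y <= 1/12.\<close>
  have t2: "t \<ge> 2"
  proof (rule ccontr)
    assume "\<not> t \<ge> 2"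
    then have "real t ^ 2 \<le> 1 ^ 2" by (intro power_mono) auto
    then show False using t_sq y(1) by simp
  qed
  have t0: "real t > 0" using t2 by simp
  have \<epsilon>1: "\<epsilon> \<le> 1 / 12"
  proof -
    have "12 * \<epsilon> * real t ^ 2 \<le> 1 * real t ^ 2" using t_sq by simp
    then have "12 * \<epsilon> \<le> 1" using t0 by (subst (asm) mult_le_cancel_right) auto
    then show ?thesis by simp
  qed
  have K: "real K \<le> y" "y / 2 \<le> real K"
  proof -
    have "real K = of_int \<lfloor>y\<rfloor>" using y(1) by (simp add: K_def)
    moreover have "\<lfloor>y\<rfloor> \<ge> 1" using y(1) by (simp add: le_floor_iff)
    ultimately show "real K \<le> y" "y / 2 \<le> real K" by linarith+
  qed
  have K12: "12 * K \<le> t ^ 2"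
  proof -
    have "real (12 * K) \<le> real (t ^ 2)" using K t_sq by simp
    then show ?thesis by (simp only: of_nat_le_iff)
  qed
  have sqx: "sqrt x \<ge> 4" using x(1) by (simp add: real_le_rsqrt)
  have N: "real N \<le> sqrt x / 2" "sqrt x / 4 \<le> real N"
  proof -
    have "\<lfloor>sqrt x / 2\<rfloor> \<ge> 0" using sqx by linarith
    then have "real N = of_int \<lfloor>sqrt x / 2\<rfloor>" by (simp add: N_def)
    then show "real N \<le> sqrt x / 2" "sqrt x / 4 \<le> real N" using sqx by linarith+
  qed
  have N_sq: "4 * real N ^ 2 \<le> x" "x / 16 \<le> real N ^ 2"
  proof -
    have "real N ^ 2 \<le> (sqrt x / 2) ^ 2" using N by (intro power_mono) auto
    then show "4 * real N ^ 2 \<le> x" using x(1) by (simp add: power_divide)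
    have "(sqrt x / 4) ^ 2 \<le> real N ^ 2" using N x(1) by (intro power_mono) auto
    then show "x / 16 \<le> real N ^ 2" using x(1) by (simp add: power_divide)
  qed
  define v where "v = real N / real t"
  have v0: "v \<ge> 0" by (simp add: v_def)
  have v_sq: "v ^ 2 \<ge> \<epsilon> * z / 16"
  proof -
    have "\<epsilon> * z / 16 * real t ^ 2 = z / 16 * (\<epsilon> * real t ^ 2)" by simp
    also have "\<dots> \<le> z / 16 * y" using t_sq(1) x(1) y(1) by (intro mult_left_mono) (auto simp: z_def)
    also have "\<dots> = x / 16" using y(1) by (simp add: z_def)
    also have "\<dots> \<le> real N ^ 2" by (rule N_sq)
    finally show ?thesis using t0 by (simp add: v_def power_divide pos_le_divide_eq)
  qed
  have z: "z \<ge> 2 ^ 24 / \<epsilon> ^ 2" using x(2) by (simp add: z_def)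
  have z\<epsilon>: "z * \<epsilon> ^ 2 \<ge> 2 ^ 24" using z assms(1) by (simp add: pos_divide_le_eq)
  have z0: "z > 0" using x(1) y(1) by (simp add: z_def)
  \<comment> \<open>Ensures sqrt v >= 30, hence H >= 30. With \<epsilon> <= 1/12 the threshold gives
    v^2 >= 12 * 2^20.\<close>
  have v_ge: "v \<ge> 900"
  proof -
    have "(2 ^ 24::real) * 12 \<le> z * \<epsilon> * 1"
    proof -
      have "z * \<epsilon> ^ 2 \<le> z * \<epsilon> * (1 / 12)"
        unfolding power2_eq_square mult.assoc[symmetric] using \<epsilon>1 z0 assms(1) by (intro mult_left_mono) auto
      then show ?thesis using z\<epsilon> by simp
    qed
    then have "900 ^ 2 \<le> v ^ 2" using v_sq by (simp add: mult.commute)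
    then show ?thesis using v0 by (rule power2_le_imp_le)
  qed
  have H: "real H \<le> sqrt v" "sqrt v / 2 \<le> real H" "H \<ge> 30"
  proof -
    have "sqrt v \<ge> 30" using v_ge by (intro real_le_rsqrt) simp
    moreover have "real H = of_int \<lfloor>sqrt v\<rfloor>" using v0 by (simp add: H_def v_def)
    moreover have "\<lfloor>sqrt v\<rfloor> \<ge> 30" using \<open>sqrt v \<ge> 30\<close> by (simp add: le_floor_iff)
    ultimately show "real H \<le> sqrt v" "sqrt v / 2 \<le> real H" "H \<ge> 30" by linarith+
  qed
  have HN: "H ^ 2 * t \<le> N"
  proof -
    have "real H ^ 2 \<le> (sqrt v) ^ 2" using H(1) by (intro power_mono) auto
    then have "real H ^ 2 * real t \<le> v * real t" using v0 t0 by (intro mult_right_mono) auto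
    also have "\<dots> = real N" using t0 by (simp add: v_def)
    finally have "real (H ^ 2 * t) \<le> real N" by simp
    then show ?thesis by (simp only: of_nat_le_iff)
  qed
  \<comment> \<open>Squaring (H / 2)^2 >= v / 16 twice gives (H / 2)^8 >= (\<epsilon> z / 2^12)^2,
    which is at least z by the threshold.\<close>
  have lnz: "0 \<le> ln z" "ln z \<le> 8 * ln (real H / 2)"
  proof -
    have "(2::real) ^ 24 \<ge> 1" by simp
    moreover have "z * \<epsilon> ^ 2 \<le> z * 1 ^ 2" using z0 assms(1) \<epsilon>1 by (intro mult_left_mono power_mono) auto
    ultimately have "z \<ge> 1" using z\<epsilon> by simp
    then show "0 \<le> ln z" by simp
    have "v = (sqrt v) ^ 2" using v0 by simp
    also have "\<dots> \<le> (2 * real H) ^ 2" using H(2) v0 by (intro power_mono) auto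
    finally have v16: "v / 16 \<le> (real H / 2) ^ 2" by (simp add: power_mult_distrib power_divide)
    have "\<epsilon> * z / 2 ^ 12 \<le> (v / 16) ^ 2" using v_sq by (simp add: power_divide)
    also have "\<dots> \<le> ((real H / 2) ^ 2) ^ 2" using v16 v0 by (intro power_mono) auto
    finally have "(\<epsilon> * z / 2 ^ 12) ^ 2 \<le> (((real H / 2) ^ 2) ^ 2) ^ 2"
      using z0 assms(1) by (intro power_mono) auto
    moreover have "z \<le> (\<epsilon> * z / 2 ^ 12) ^ 2"
    proof -
      have "z * 2 ^ 24 \<le> z * (z * \<epsilon> ^ 2)" using z\<epsilon> z0 by (intro mult_left_mono) auto
      then show ?thesis by (simp add: power_mult_distrib power_divide power2_eq_square mult_ac)
    qed
    ultimately have "z \<le> (real H / 2) ^ 8" by (simp flip: power_mult)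
    then have "ln z \<le> ln ((real H / 2) ^ 8)" using z0 by (intro ln_mono) auto
    also have "\<dots> = 8 * ln (real H / 2)" using H(3) by (subst ln_realpow) auto
    finally show "ln z \<le> 8 * ln (real H / 2)" .
  qed
  have tN: "t \<le> N"
  proof -
    have "1 * t \<le> H ^ 2 * t" using H(3) by (intro mult_le_mono1) auto
    also have "\<dots> \<le> N" by (rule HN)
    finally show ?thesis by simp
  qed
  have fit: "real n + real K \<le> x" if "n \<in> {1..3 * N ^ 2}" for n
  proof -
    have "n \<le> 3 * N ^ 2" using that by simp
    then have "real n \<le> real (3 * N ^ 2)" by (simp only: of_nat_le_iff)
    then have "real n \<le> 3 * real N ^ 2" by simp
    moreover have "real t ^ 2 \<le> real N ^ 2" using tN by (intro power_mono) auto
    moreover have "real K \<le> real t ^ 2" using K(1) t_sq(2) y(1) by linarith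
    ultimately show ?thesis using N_sq(1) by linarith
  qed
  have "\<epsilon> / 2 ^ 24 * x * y * ln z ^ 3 \<le> real K ^ 2 * real N ^ 2 / (384 * real t ^ 2) * ln (real H / 2) ^ 3"
  proof -
    have "\<epsilon> * y * x / (64 * 384) * real t ^ 2 = (\<epsilon> * real t ^ 2) * y * x / (64 * 384)" by simp
    also have "\<dots> \<le> y * y * x / (64 * 384)"
      using t_sq(1) y(1) x(1) by (intro divide_right_mono mult_right_mono) auto
    also have "\<dots> = (y / 2) ^ 2 * (x / 16) / 384" by (simp add: power2_eq_square)
    also have "\<dots> \<le> real K ^ 2 * real N ^ 2 / 384"
      using K(2) y(1) N_sq(2) x(1) by (intro divide_right_mono mult_mono power_mono) auto
    finally have 1: "\<epsilon> * y * x / (64 * 384) \<le> real K ^ 2 * real N ^ 2 / (384 * real t ^ 2)"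
      using t0 by (simp add: field_simps)
    have "(ln z / 8) ^ 3 \<le> ln (real H / 2) ^ 3" using lnz by (intro power_mono) auto
    then have "\<epsilon> * y * x / (64 * 384) * (ln z / 8) ^ 3
        \<le> real K ^ 2 * real N ^ 2 / (384 * real t ^ 2) * ln (real H / 2) ^ 3"
      using 1 lnz assms(1) y(1) x(1) by (intro mult_mono) auto
    \<comment> \<open>The accumulated constant is 64 * 384 * 8^3, rounded up to 2^24.\<close>
    moreover have "\<epsilon> / 2 ^ 24 * x * y * ln z ^ 3 \<le> \<epsilon> * y * x / (64 * 384) * (ln z / 8) ^ 3"
    proof -
      have "0 \<le> \<epsilon> * x * y * ln z ^ 3" using assms(1) x(1) y(1) lnz(1) by (intro mult_nonneg_nonneg) auto
      then have "(\<epsilon> * x * y * ln z ^ 3) / 2 ^ 24 \<le> (\<epsilon> * x * y * ln z ^ 3) / (64 * 384 * 512)"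
        by (intro divide_left_mono) auto
      then show ?thesis by (simp add: power_divide mult_ac)
    qed
    ultimately show ?thesis by linarith
  qed
  also have "\<dots> \<le> (\<Sum>n\<in>{1..3 * N ^ 2}. (norm (window_sum \<alpha> K n)) ^ 2)"
  proof (rule sum_window_sum_ge)
    show "coprime u (int t)" using assms(3) by (simp only: t(1))
    show "\<bar>\<alpha> - of_int u / real t\<bar> \<le> 1 / real t ^ 2" using assms(4) by (simp only: t(2))
  qed (use t2 K12 H(3) HN in auto)
  also have "\<dots> = (\<Sum>n\<in>{1..3 * N ^ 2}. (cmod (short_sum \<alpha> x y (int n))) ^ 2)"
    unfolding K_def using fit y(1) by (intro sum.cong refl) (simp add: short_sum_eq_window_sum K_def)
  also have "\<dots> = (\<Sum>n\<in>int ` {1..3 * N ^ 2}. (cmod (short_sum \<alpha> x y n)) ^ 2)"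
    by (simp add: sum.reindex)
  also have "\<dots> \<le> (\<Sum>n\<in>{n::int. - y < of_int n \<and> of_int n \<le> x}. (cmod (short_sum \<alpha> x y n)) ^ 2)"
  proof (rule sum_mono2[OF finite_real_of_int_interval])
    show "int ` {1..3 * N ^ 2} \<subseteq> {n::int. - y < of_int n \<and> of_int n \<le> x}"
    proof
      fix n assume "n \<in> int ` {1..3 * N ^ 2}"
      then obtain k where "k \<in> {1..3 * N ^ 2}" "n = int k" by blast
      then show "n \<in> {n::int. - y < of_int n \<and> of_int n \<le> x}" using fit[of k] y(1) by auto
    qed
  qed auto
  finally show ?thesis by (simp add: z_def)
qed

section \<open>Assembling the mean square bound with C = 1\<close>

lemma Ybound_1_le:
  assumes "x \<ge> 3"
  shows "Ybound 1 x \<le> x"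
proof -
  have "ln (exp 1) \<le> ln x" using assms exp_le by (intro ln_mono) auto
  then have "ln x \<ge> 1" by simp
  then have "0 \<le> ln (ln x)" "ln (ln x) \<le> ln x" using ln_le_minus_one[of "ln x"] by auto
  then have "(ln (ln x) / (1 * ln x)) ^ 2 \<le> 1"
    using \<open>ln x \<ge> 1\<close> by (intro power_le_one) auto
  then show ?thesis unfolding Ybound_def using assms by (simp add: mult_left_le)
qed

text \<open>Since Y <= x, the factor ln(Y/y) is at most ln(x/y) and a cubic bound suffices. The
  condition y <= Y says x/y >= (ln x / ln ln x)^2, which passes the threshold of
  \<open>sum_short_sum_ge\<close> from some X depending on \<epsilon> alone.\<close>

lemma mean_square_lower_bound:
  assumes "\<epsilon> > 0"
  shows "\<exists>c::real. c > 0 \<and>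
               (\<forall>(\<alpha>::real) (x::real) (y::real).
                  x \<ge> 3 \<longrightarrow> 1 \<le> y \<longrightarrow> y \<le> Ybound 1 x \<longrightarrow>
                  (\<exists>(u::int) (s::int). s \<ge> 1 \<and> coprime u s \<and>
                     \<bar>\<alpha> - of_int u / of_int s\<bar> \<le> 1 / (of_int s) ^ 2 \<and>
                     \<epsilon> * (of_int s) ^ 2 \<le> y \<and> y \<le> (of_int s) ^ 2 / 12) \<longrightarrow>
                  (1 / x) * (\<Sum>n\<in>{n::int. - y < of_int n \<and> of_int n \<le> x}.
                                (cmod (short_sum \<alpha> x y n)) ^ 2)
                    \<ge> c * y * (ln (x / y)) ^ 2 * ln (Ybound 1 x / y))"
proof -
  have "filterlim (\<lambda>x::real. (ln x / ln (ln x)) ^ 2) at_top at_top" by real_asymp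
  then have "eventually (\<lambda>x::real. (ln x / ln (ln x)) ^ 2 \<ge> 2 ^ 24 / \<epsilon> ^ 2) at_top"
    by (simp add: filterlim_at_top)
  then obtain X1 where X1: "\<And>x. x \<ge> X1 \<Longrightarrow> (ln x / ln (ln x)) ^ 2 \<ge> 2 ^ 24 / \<epsilon> ^ 2"
    by (auto simp: eventually_at_top_linorder)
  define X where "X = max 16 X1"
  have X: "X \<ge> 16" by (simp add: X_def)
  \<comment> \<open>The second entry serves x < X: there y ln(x/y)^3 <= X ln(X)^3, so the target is
    at most 1 / X, below the trivial bound 1 / x.\<close>
  define c where "c = min (\<epsilon> / 2 ^ 24) (1 / (X ^ 2 * ln X ^ 3))"
  have lnX: "ln X > 0" using X by simp
  have c: "c > 0" using assms X lnX by (simp add: c_def)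
  show ?thesis
  proof (intro exI[of _ c] conjI allI impI c)
    fix \<alpha> x y :: real
    assume x: "x \<ge> 3" and y: "1 \<le> y" and yY: "y \<le> Ybound 1 x"
      and "\<exists>(u::int) (s::int). s \<ge> 1 \<and> coprime u s \<and>
                     \<bar>\<alpha> - of_int u / of_int s\<bar> \<le> 1 / (of_int s) ^ 2 \<and>
                     \<epsilon> * (of_int s) ^ 2 \<le> y \<and> y \<le> (of_int s) ^ 2 / 12"
    then obtain u s :: int where us: "s \<ge> 1" "coprime u s" "\<bar>\<alpha> - of_int u / of_int s\<bar> \<le> 1 / (of_int s) ^ 2"
       "\<epsilon> * (of_int s) ^ 2 \<le> y" "y \<le> (of_int s) ^ 2 / 12" by blast
    define T where "T = (\<Sum>n\<in>{n::int. - y < of_int n \<and> of_int n \<le> x}. (cmod (short_sum \<alpha> x y n)) ^ 2)"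
    define z where "z = x / y"
    have yx: "y \<le> x" using yY Ybound_1_le[OF x] by simp
    have z1: "z \<ge> 1" "z \<le> x" using yx y x by (simp_all add: z_def divide_le_eq)
    have lnz: "ln z \<ge> 0" using z1 by simp
    have "ln (Ybound 1 x / y) \<le> ln z"
      unfolding z_def using yY y Ybound_1_le[OF x] by (intro ln_mono divide_right_mono) auto
    then have "c * y * ln z ^ 2 * ln (Ybound 1 x / y) \<le> c * y * ln z ^ 2 * ln z"
      using c y by (intro mult_left_mono) auto
    also have "\<dots> = c * y * ln z ^ 3" by (simp add: power2_eq_square power3_eq_cube)
    also have "\<dots> \<le> 1 / x * T"
    proof (cases "x \<ge> X")
      case True
      have "ln (ln x) > 0"
      proof -
        have "ln (exp 1) < ln x" using True X exp_le by (intro ln_less_cancel_iff[THEN iffD2]) auto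
        then show ?thesis by simp
      qed
      moreover have "ln x > 0" using x by simp
      ultimately have "(ln x / ln (ln x)) ^ 2 * y \<le> (ln x / ln (ln x)) ^ 2 * (x * (ln (ln x) / (1 * ln x)) ^ 2)"
        using yY unfolding Ybound_def by (intro mult_left_mono) auto
      also have "\<dots> = x" using \<open>ln (ln x) > 0\<close> \<open>ln x > 0\<close> by (simp add: field_simps)
      finally have "(ln x / ln (ln x)) ^ 2 \<le> z" using y by (simp add: z_def pos_le_divide_eq)
      then have "z \<ge> 2 ^ 24 / \<epsilon> ^ 2" using X1[of x] True by (simp add: X_def)
      then have "\<epsilon> / 2 ^ 24 * x * y * ln z ^ 3 \<le> T"
        unfolding T_def z_def using us y True X assms by (intro sum_short_sum_ge) auto
      then have "\<epsilon> / 2 ^ 24 * (y * ln z ^ 3) \<le> 1 / x * T" using x by (simp add: field_simps)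
      moreover have "c * (y * ln z ^ 3) \<le> \<epsilon> / 2 ^ 24 * (y * ln z ^ 3)"
        using y lnz by (intro mult_right_mono mult_nonneg_nonneg) (auto simp: c_def)
      ultimately have "c * (y * ln z ^ 3) \<le> 1 / x * T" by linarith
      then show ?thesis by (simp only: mult.assoc)
    next
      case False
      have "ln z ^ 3 \<le> ln X ^ 3" using False z1 lnz by (intro power_mono ln_mono) auto
      then have yz: "y * ln z ^ 3 \<le> X * ln X ^ 3"
        using yx False y lnz by (intro mult_mono) auto
      have "c * (y * ln z ^ 3) \<le> 1 / (X ^ 2 * ln X ^ 3) * (X * ln X ^ 3)"
      proof (rule mult_mono[OF _ yz])
        show "c \<le> 1 / (X ^ 2 * ln X ^ 3)" by (simp add: c_def)
      qed (use y lnz lnX in auto)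
      also have "\<dots> = 1 / X" using X lnX by (simp add: power2_eq_square)
      also have "\<dots> \<le> 1 / x" using False x by (intro divide_left_mono) auto
      also have "\<dots> \<le> 1 / x * T"
        using sum_short_sum_ge_1[of y x \<alpha>] y x mult_left_mono[of 1 T "1 / x"] by (simp add: T_def)
      finally show ?thesis by (simp add: mult.assoc)
    qed
    finally show "(1 / x) * (\<Sum>n\<in>{n::int. - y < of_int n \<and> of_int n \<le> x}. (cmod (short_sum \<alpha> x y n)) ^ 2)
        \<ge> c * y * (ln (x / y)) ^ 2 * ln (Ybound 1 x / y)"
      by (simp add: T_def z_def)
  qed
qed

section \<open>Large values of the long sum\<close>

text \<open>\<open>sum_window_sum_ge\<close> with the least admissible H = 30 and the longest
  admissible window. Some of the 3 N^2 windows reaches the average, and one of the two long sums at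
  its ends carries half of it.\<close>

lemma long_sum_large_value:
  fixes u s :: int
  assumes "coprime u s" "s \<ge> 4" "\<bar>\<alpha> - of_int u / of_int s\<bar> \<le> 1 / (of_int s) ^ 2"
  obtains t :: nat where "t \<ge> 1" "real t \<le> (1800 * of_int s) ^ 2" "norm (long_sum \<alpha> (real t)) \<ge> of_int s / 1632"
proof -
  define q where "q = nat s"
  have q: "int q = s" "real q = of_int s" "q \<ge> 4" using assms(2) by (simp_all add: q_def)
  define N where "N = 30 ^ 2 * q"
  define K where "K = q ^ 2 div 12"
  have K: "12 * K \<le> q ^ 2" "real q ^ 2 / 24 \<le> real K"
  proof -
    show "12 * K \<le> q ^ 2" by (simp add: K_def)
    have "(4::nat) ^ 2 \<le> q ^ 2" using q(3) by (rule power_mono) simp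
    moreover have "p \<le> 24 * (p div 12)" if "16 \<le> p" for p :: nat using that by presburger
    ultimately have "q ^ 2 \<le> 24 * K" unfolding K_def by simp
    then have "real (q ^ 2) \<le> real (24 * K)" by (simp only: of_nat_le_iff)
    then show "real q ^ 2 / 24 \<le> real K" by simp
  qed
  \<comment> \<open>The average over 3 N^2 windows: 1152 = 3 * 384, with the logarithm bounded below
    by 1.\<close>
  define B where "B = real K ^ 2 / (1152 * real q ^ 2)"
  have N0: "real N > 0" using q(3) by (simp add: N_def)
  have "ln (exp 1) \<le> ln (15::real)" using exp_le by (intro ln_mono) auto
  then have ln15: "1 \<le> ln (real 30 / 2) ^ 3" by (simp add: one_le_power)
  have "(\<Sum>n\<in>{1..3 * N ^ 2}. B) = real K ^ 2 * real N ^ 2 / (384 * real q ^ 2) * 1"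
    by (simp add: B_def)
  also have "\<dots> \<le> real K ^ 2 * real N ^ 2 / (384 * real q ^ 2) * ln (real 30 / 2) ^ 3"
    by (intro mult_left_mono ln15) simp
  also have "\<dots> \<le> (\<Sum>n\<in>{1..3 * N ^ 2}. (norm (window_sum \<alpha> K n)) ^ 2)"
  proof (rule sum_window_sum_ge)
    show "coprime u (int q)" using assms(1) by (simp only: q(1))
    show "\<bar>\<alpha> - of_int u / real q\<bar> \<le> 1 / real q ^ 2" using assms(3) by (simp only: q(2))
  qed (use q(3) K(1) in \<open>auto simp: N_def\<close>)
  finally have "\<not> (\<forall>n\<in>{1..3 * N ^ 2}. (norm (window_sum \<alpha> K n)) ^ 2 < B)"
    using sum_strict_mono[of "{1..3 * N ^ 2}" "\<lambda>n. (norm (window_sum \<alpha> K n)) ^ 2" "\<lambda>_. B"] N0 by fastforce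
  then obtain n where n: "1 \<le> n" "n \<le> 3 * N ^ 2" "B \<le> (norm (window_sum \<alpha> K n)) ^ 2"
    by (auto simp: not_less)
  \<comment> \<open>With K >= q^2 / 24 one needs 816^2 >= 24^2 * 1152.\<close>
  have "(real q / 816) ^ 2 \<le> B"
  proof -
    have "(real q ^ 2 / 24) ^ 2 \<le> real K ^ 2" using K(2) by (intro power_mono) auto
    then have "(real q ^ 2 / 24) ^ 2 / (1152 * real q ^ 2) \<le> B"
      unfolding B_def by (intro divide_right_mono) auto
    moreover have "(real q / 816) ^ 2 \<le> (real q ^ 2 / 24) ^ 2 / (1152 * real q ^ 2)"
      using q(3) by (simp add: field_simps power2_eq_square)
    ultimately show ?thesis by linarith
  qed
  then have "(real q / 816) ^ 2 \<le> (norm (window_sum \<alpha> K n)) ^ 2" using n(3) by linarith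
  then have "real q / 816 \<le> norm (window_sum \<alpha> K n)" by (rule power2_le_imp_le) simp
  also have "\<dots> \<le> norm (long_sum \<alpha> (real (n + K))) + norm (long_sum \<alpha> (real n))"
    unfolding long_sum_diff_eq_window_sum[symmetric] by (rule norm_triangle_ineq4)
  finally have or: "real q / 1632 \<le> norm (long_sum \<alpha> (real (n + K))) \<or> real q / 1632 \<le> norm (long_sum \<alpha> (real n))"
    by linarith
  have "K \<le> q ^ 2" using K by simp
  also have "\<dots> \<le> N ^ 2" unfolding N_def by (intro power_mono) auto
  finally have "n + K \<le> 4 * N ^ 2" using n(2) by simp
  \<comment> \<open>1800 = 2 * 30^2, from N = 30^2 q.\<close>
  also have "4 * N ^ 2 = (1800 * q) ^ 2" by (simp add: N_def power_mult_distrib)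
  finally have "real (n + K) \<le> real ((1800 * q) ^ 2)" by (simp only: of_nat_le_iff)
  then have "real (n + K) \<le> (1800 * of_int s) ^ 2" by (simp flip: q(2))
  then show ?thesis using or n(1) that[of n] that[of "n + K"] q(2) by auto
qed

lemma Limsup_long_sum_pos:
  assumes "\<alpha> \<notin> \<rat>"
  shows "Limsup at_top (\<lambda>x::real. ereal (x powr (- 1 / 2) * ln x * (ln (ln x)) powi (- 2) * cmod (long_sum \<alpha> x))) > 0"
proof -
  define f where "f x = x powr (- 1 / 2) * ln x * (ln (ln x)) powi (- 2) * cmod (long_sum \<alpha> x)" for x :: real
  define \<delta> :: real where "\<delta> = 1 / (1632 * 1800)"
  \<comment> \<open>The logarithmic factors tend to infinity, so it suffices that the long sum is at
    least \<delta> sqrt x for arbitrarily large x.\<close>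
  have "eventually (\<lambda>x::real. ln x * (ln (ln x)) powi (- 2) \<ge> 1) at_top"
  proof -
    have "eventually (\<lambda>x::real. ln x / (ln (ln x)) ^ 2 \<ge> 1) at_top" by real_asymp
    then show ?thesis by (simp add: power_int_minus divide_inverse)
  qed
  then obtain X where X: "\<And>x::real. x \<ge> X \<Longrightarrow> ln x * (ln (ln x)) powi (- 2) \<ge> 1"
    by (auto simp: eventually_at_top_linorder)
  have large: "\<exists>x\<ge>X0. f x \<ge> \<delta>" for X0
  proof -
    define M where "M = nat \<lceil>max X X0\<rceil>"
    \<comment> \<open>B bounds every long sum up to M. A denominator s > 1632 B forces a value above
      B, hence t > M; irrationality of \<alpha> supplies such s by Dirichlet's approximation
      theorem.\<close>
    define B where "B = (\<Sum>t\<in>{1..M}. norm (long_sum \<alpha> (real t)))"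
    have "infinite (approx_set \<alpha>)" using assms rational_iff_finite_approx_set by blast
    then obtain h s :: int where hs: "(h, s) \<in> approx_set \<alpha>" "s > max 4 \<lceil>1632 * B\<rceil>"
      using infinite_approx_set by blast
    then have "coprime h s" "s \<ge> 4" "\<bar>\<alpha> - of_int h / of_int s\<bar> \<le> 1 / (of_int s) ^ 2"
      by (auto simp: approx_set_def)
    then obtain t where t: "t \<ge> 1" "real t \<le> (1800 * of_int s) ^ 2" "norm (long_sum \<alpha> (real t)) \<ge> of_int s / 1632"
      by (rule long_sum_large_value)
    have "t > M"
    proof (rule ccontr)
      assume "\<not> t > M"
      then have "norm (long_sum \<alpha> (real t)) \<le> B"
        unfolding B_def using t(1) by (intro member_le_sum) auto
      moreover have "of_int s > 1632 * B" using hs(2) by linarith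
      ultimately show False using t(3) by simp
    qed
    then have tX: "real t \<ge> X" "real t \<ge> X0" unfolding M_def by linarith+
    have s0: "of_int s > (0::real)" using \<open>s \<ge> 4\<close> by simp
    have "sqrt (real t) \<le> 1800 * of_int s"
      using t(2) s0 by (intro real_le_lsqrt) auto
    then have "\<delta> * sqrt (real t) \<le> norm (long_sum \<alpha> (real t))" using t(3) by (simp add: \<delta>_def)
    then have "real t powr (- 1 / 2) * (\<delta> * sqrt (real t)) \<le> real t powr (- 1 / 2) * norm (long_sum \<alpha> (real t))"
      by (intro mult_left_mono) auto
    moreover have "real t powr (- 1 / 2) * (\<delta> * sqrt (real t)) = \<delta>"
      using t(1) by (simp add: powr_minus powr_half_sqrt)
    ultimately have "\<delta> \<le> 1 * (real t powr (- 1 / 2) * norm (long_sum \<alpha> (real t)))" by (simp only: mult_1)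
    also have "\<dots> \<le> (ln (real t) * (ln (ln (real t))) powi (- 2)) * (real t powr (- 1 / 2) * norm (long_sum \<alpha> (real t)))"
      using X[OF tX(1)] by (intro mult_right_mono) auto
    also have "\<dots> = f (real t)" by (simp add: f_def mult_ac)
    finally show ?thesis using tX(2) by blast
  qed
  have "ereal \<delta> \<le> Limsup at_top (\<lambda>x. ereal (f x))"
  proof (rule ccontr)
    assume "\<not> ereal \<delta> \<le> Limsup at_top (\<lambda>x. ereal (f x))"
    then have "eventually (\<lambda>x. ereal (f x) < ereal \<delta>) at_top"
      by (intro Limsup_lessD) auto
    then obtain X0 where "\<And>x::real. x \<ge> X0 \<Longrightarrow> f x < \<delta>" by (auto simp: eventually_at_top_linorder)
    then show False using large[of X0] by (auto simp: not_le[symmetric])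
  qed
  moreover have "ereal \<delta> > 0" by (simp add: \<delta>_def)
  ultimately show ?thesis unfolding f_def by (rule less_le_trans[rotated])
qed

theorem theorem1p6:
  shows "(\<exists>C::real. C > 0 \<and>
           (\<forall>\<epsilon>::real. \<epsilon> > 0 \<longrightarrow>
             (\<exists>c::real. c > 0 \<and>
               (\<forall>(\<alpha>::real) (x::real) (y::real).
                  x \<ge> 3 \<longrightarrow> 1 \<le> y \<longrightarrow> y \<le> Ybound C x \<longrightarrow>
                  (\<exists>(u::int) (s::int). s \<ge> 1 \<and> coprime u s \<and>
                     \<bar>\<alpha> - of_int u / of_int s\<bar> \<le> 1 / (of_int s) ^ 2 \<and>
                     \<epsilon> * (of_int s) ^ 2 \<le> y \<and> y \<le> (of_int s) ^ 2 / 12) \<longrightarrow>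
                  (1 / x) * (\<Sum>n\<in>{n::int. - y < of_int n \<and> of_int n \<le> x}.
                                (cmod (short_sum \<alpha> x y n)) ^ 2)
                    \<ge> c * y * (ln (x / y)) ^ 2 * ln (Ybound C x / y)))))
         \<and>
         (\<forall>\<alpha>::real. \<alpha> \<notin> \<rat> \<longrightarrow>
            Limsup at_top (\<lambda>x::real.
              ereal (x powr (- 1 / 2) * ln x * (ln (ln x)) powi (- 2) * cmod (long_sum \<alpha> x))) > 0)"
proof (intro conjI allI impI)
  show "\<exists>C::real. C > 0 \<and>
           (\<forall>\<epsilon>::real. \<epsilon> > 0 \<longrightarrow>
             (\<exists>c::real. c > 0 \<and>
               (\<forall>(\<alpha>::real) (x::real) (y::real).
                  x \<ge> 3 \<longrightarrow> 1 \<le> y \<longrightarrow> y \<le> Ybound C x \<longrightarrow>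
                  (\<exists>(u::int) (s::int). s \<ge> 1 \<and> coprime u s \<and>
                     \<bar>\<alpha> - of_int u / of_int s\<bar> \<le> 1 / (of_int s) ^ 2 \<and>
                     \<epsilon> * (of_int s) ^ 2 \<le> y \<and> y \<le> (of_int s) ^ 2 / 12) \<longrightarrow>
                  (1 / x) * (\<Sum>n\<in>{n::int. - y < of_int n \<and> of_int n \<le> x}.
                                (cmod (short_sum \<alpha> x y n)) ^ 2)
                    \<ge> c * y * (ln (x / y)) ^ 2 * ln (Ybound C x / y))))"
    by (intro exI[of _ 1] conjI allI impI mean_square_lower_bound) simp
qed (rule Limsup_long_sum_pos)

end
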